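(* Let $(\mathcal X^+,\mathcal X^-)$ be the generalized projective geometry associated to a Jordan pair over $\mathbb K$, let $a,b\in\mathcal X^-$ be such that $\mathcal U_{a,b}:=\mathfrak v_a\cap\mathfrak v_b$ is non-empty, and equip $\mathcal U_{a,b}$ with the symmetric space structure $\mu(x,y)=\Pi_{-1}\bigl(x,\Pi_{1/2}(a,x,b),y\bigr)$. Fix $o':=b$ as base point in $\mathcal X^-$, choose an arbitrary base point $o\in\mathfrak v_a\cap\mathfrak v_b$, and write $(V^+,V^-)$ for the Jordan pair associated to the base point $(o,o')$, so that $V^+=\mathfrak v_{o'}$ with origin $o$, $V^-=\mathfrak v_o$ with origin $o'$, and $a\in V^-$. Then $\mathcal U_{a,b}=\mathcal U_{a,o'}$ is naturally identified with $$\mathcal U_a=\{x\in V^+\mid B(x,-a)\in\mathrm{GL}(V^+)\},$$ and in the global chart $V^+$ of $\mathcal U_{a,b}$ the symmetric space structure $\mu$ is given by the explicit formula $\mu(x,y)=\mathcal Q(x)\sigma_0(y)$, where $$\mathcal Q(x)=\tau_{2x+Q(x)a}\circ B(x,-a),\qquad \sigma_0=-\tilde\tau_{-a}=\tilde\tau_a\circ(-\mathrm{id}).$$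
   Context: $\mathbb K$ is a commutative ring in which $2$ and $3$ are invertible. A (linear) Jordan pair is a pair of $\mathbb K$-modules $(V^+,V^-)$ with trilinear maps $T^\pm:V^\pm\times V^\mp\times V^\pm\to V^\pm$ such that $T^\pm(x,y,z)=T^\pm(z,y,x)$ and $T^\pm(u,v,T^\pm(x,y,z))=T^\pm(T^\pm(u,v,x),y,z)-T^\pm(x,T^\mp(v,u,y),z)+T^\pm(x,y,T^\pm(u,v,z))$. Write $T(x,y)=T^\pm(x,y,\cdot)$, $Q(x)=\tfrac12T^\pm(x,\cdot,x)$, $B(x,y)=\mathrm{id}-T(x,y)+Q(x)Q(y)$ and, if $B(x,y)$ is invertible, $\tilde\tau_y(x)=B(x,y)^{-1}(x-Q(x)y)$. $\tau_v$ is translation by $v$. Associated geometry. Let $\mathfrak g=\mathfrak g_1\oplus\mathfrak g_0\oplus\mathfrak g_{-1}$ be the 3-graded Lie algebra with $\mathfrak g_{\pm1}=V^\pm$ abelian, $\mathfrak g_0\subset\mathrm{End}(V^+)\times\mathrm{End}(V^-)$ the Lie algebra spanned by $(\mathrm{id},-\mathrm{id})$ and all $D(x,y)=(T^+(x,y,\cdot),-T^-(y,x,\cdot))$, acting naturally on $V^\pm$, and $[x,y]=D(x,y)$ for $x\in V^+,y\in V^-$; thus $T^\pm(x,y,z)=[[x,y],z]$. For $x\in\mathfrak g_{\pm1}$, $\exp(x):=\exp(\mathrm{ad}\,x)\in\mathrm{Aut}(\mathfrak g)$. Let $U^\pm=\exp(\mathfrak g_{\pm1})$, $G=\langle U^+,U^-\rangle$,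 $H$ the subgroup of $G$ of elements preserving the 3-grading, $P^\pm=U^\pm H$, $\mathcal X^+=G/P^-$, $\mathcal X^-=G/P^+$, $o^+=eP^-$, $o^-=eP^+$. Elements $x\in\mathcal X^+$ and $a\in\mathcal X^-$ are transversal, $x\top a$, if $(x,a)=(g.o^+,g.o^-)$ for some $g\in G$. For $a\in\mathcal X^-$, $\mathfrak v_a=\{x\in\mathcal X^+\mid x\top a\}$; for $x\in\mathcal X^+$, $\mathfrak v_x=\{a\in\mathcal X^-\mid x\top a\}$. The set $\mathfrak v_{o^-}=U^+.o^+$ is identified with $V^+$ via $x\mapsto\exp(x).o^+$, and $\mathfrak v_{o^+}=U^-.o^-$ with $V^-$ via $a\mapsto\exp(-a).o^-$ (this choice of sign makes translation by $x\in V^+$ act on $V^-$ by the quasi-inverse $\tilde\tau_x$, and vice versa). These are affine spaces over $\mathbb K$; for $g\in G$ the sets $\mathfrak v_{g.o^\mp}=g.\mathfrak v_{o^\mp}$ carry the transported affine structures (independent of choices). For $r\in\mathbb K$ and $x,y\in\mathfrak v_a$, $\Pi_r(x,a,y)$ is the element $(1-r)x+ry$ of the affine space $\mathfrak v_a$; dually for $\Pi_r(a,x,b)$ with $a,b\in\mathfrak v_x$. For invertible $r$, the map $y\mapsto\Pi_r(x,a,y)$ extends to a bijection of $\mathcal X^+$ that is the first component of an automorphism of the geometry, and this extension is understood in the formula for $\mu$. Jordan pair of a base point: if $(o,o')$ is a transversal pair, write $(o,o')=(g.o^+,g.o^-)$ with $g\in G$; the $\mathbb K$-modules $\mathfrak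 v_{o'}$ (origin $o$) and $\mathfrak v_o$ (origin $o'$) are identified via $g$ with $\mathfrak v_{o^-}=V^+$ and $\mathfrak v_{o^+}=V^-$, and the trilinear maps $T^\pm$ are transported by $g$; the result does not depend on the choice of $g$. *)

theory Defs
  imports
    Complex_Main
    "HOL-Algebra.Bij"
    "HOL-Algebra.Generated_Groups"
    "HOL-Algebra.Left_Coset"
    "HOL-Library.Function_Algebras"
    "HOL-Library.Product_Plus"
begin

section \<open>Jordan pairs\<close>

definition ring_inv :: "'k::comm_ring_1 \<Rightarrow> 'k" where
  "ring_inv r = (THE s. r * s = 1)"

record ('k, 'p, 'm) jordan_data =
  scale_p :: "'k \<Rightarrow> 'p \<Rightarrow> 'p"
  scale_m :: "'k \<Rightarrow> 'm \<Rightarrow> 'm"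
  Tp :: "'p \<Rightarrow> 'm \<Rightarrow> 'p \<Rightarrow> 'p"
  Tm :: "'m \<Rightarrow> 'p \<Rightarrow> 'm \<Rightarrow> 'm"

locale jordan_pair =
  fixes J :: "('k::comm_ring_1, 'p::ab_group_add, 'm::ab_group_add) jordan_data"
  assumes two_invertible: "(2::'k) dvd 1"
    and three_invertible: "(3::'k) dvd 1"
    and module_p: "module (scale_p J)"
    and module_m: "module (scale_m J)"
    and Tp_linear1: "module_hom (scale_p J) (scale_p J) (\<lambda>x. Tp J x y z)"
    and Tp_linear2: "module_hom (scale_m J) (scale_p J) (\<lambda>y. Tp J x y z)"
    and Tp_linear3: "module_hom (scale_p J) (scale_p J) (\<lambda>z. Tp J x y z)"
    and Tm_linear1: "module_hom (scale_m J) (scale_m J) (\<lambda>x'. Tm J x' y' z')"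
    and Tm_linear2: "module_hom (scale_p J) (scale_m J) (\<lambda>y'. Tm J x' y' z')"
    and Tm_linear3: "module_hom (scale_m J) (scale_m J) (\<lambda>z'. Tm J x' y' z')"
    and Tp_sym: "Tp J x y z = Tp J z y x"
    and Tm_sym: "Tm J x' y' z' = Tm J z' y' x'"
    and Tp_jordan: "Tp J u v (Tp J x y z) =
      Tp J (Tp J u v x) y z - Tp J x (Tm J v u y) z + Tp J x y (Tp J u v z)"
    and Tm_jordan: "Tm J u' v' (Tm J x' y' z') =
      Tm J (Tm J u' v' x') y' z' - Tm J x' (Tp J v' u' y') z' + Tm J x' y' (Tm J u' v' z')"

definition Qp :: "('k::comm_ring_1, 'p, 'm) jordan_data \<Rightarrow> 'p \<Rightarrow> 'm \<Rightarrow> 'p" where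
  "Qp J x = (\<lambda>y. scale_p J (ring_inv 2) (Tp J x y x))"

definition Qm :: "('k::comm_ring_1, 'p, 'm) jordan_data \<Rightarrow> 'm \<Rightarrow> 'p \<Rightarrow> 'm" where
  "Qm J y = (\<lambda>x. scale_m J (ring_inv 2) (Tm J y x y))"

definition Bergman :: "('k::comm_ring_1, 'p::ab_group_add, 'm) jordan_data \<Rightarrow> 'p \<Rightarrow> 'm \<Rightarrow> 'p \<Rightarrow> 'p" where
  "Bergman J x y = (\<lambda>z. z - Tp J x y z + Qp J x (Qm J y z))"

definition GL_p :: "('k::comm_ring_1, 'p::ab_group_add, 'm) jordan_data \<Rightarrow> ('p \<Rightarrow> 'p) set" where
  "GL_p J = {f. module_hom (scale_p J) (scale_p J) f \<and> bij f}"

text \<open>The partial map \<open>\<tau>\<^sup>~\<^sub>y\<close>; meaningful at \<open>x\<close> if \<open>B(x,y)\<close> is invertible.\<close>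

definition quasi_inverse :: "('k::comm_ring_1, 'p::ab_group_add, 'm) jordan_data \<Rightarrow> 'm \<Rightarrow> 'p \<Rightarrow> 'p" where
  "quasi_inverse J y x = inv_into UNIV (Bergman J x y) (x - Qp J x y)"

definition translation :: "'p::ab_group_add \<Rightarrow> 'p \<Rightarrow> 'p" where
  "translation v = (\<lambda>x. x + v)"


section \<open>The 3-graded Lie algebra\<close>

text \<open>
  \<open>(x, (A, A'), y)\<close> stands for \<open>x + (A, A') + y\<close> with \<open>x \<in> \<gg>\<^sub>1 = V\<^sup>+\<close>,
  \<open>(A, A') \<in> \<gg>\<^sub>0\<close> and \<open>y \<in> \<gg>\<^sub>-\<^sub>1 = V\<^sup>-\<close>. The Lie algebra is the subset \<open>lie\<close> of this type.
\<close>

type_synonym ('p, 'm) tkk = "'p \<times> (('p \<Rightarrow> 'p) \<times> ('m \<Rightarrow> 'm)) \<times> 'm"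

definition inner_der :: "('k, 'p, 'm::ab_group_add) jordan_data \<Rightarrow> 'p \<Rightarrow> 'm \<Rightarrow> ('p \<Rightarrow> 'p) \<times> ('m \<Rightarrow> 'm)" where
  "inner_der J x y = (\<lambda>z. Tp J x y z, \<lambda>z. - Tm J y x z)"

definition scale_0 :: "('k, 'p, 'm) jordan_data \<Rightarrow> 'k
    \<Rightarrow> ('p \<Rightarrow> 'p) \<times> ('m \<Rightarrow> 'm) \<Rightarrow> ('p \<Rightarrow> 'p) \<times> ('m \<Rightarrow> 'm)" where
  "scale_0 J r A = (\<lambda>z. scale_p J r (fst A z), \<lambda>z. scale_m J r (snd A z))"

definition lie0 :: "('k::comm_ring_1, 'p::ab_group_add, 'm::ab_group_add) jordan_data
    \<Rightarrow> (('p \<Rightarrow> 'p) \<times> ('m \<Rightarrow> 'm)) set" where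
  "lie0 J = module.span (scale_0 J) (insert (\<lambda>z. z, \<lambda>z. - z) {inner_der J x y | x y. True})"

definition lie :: "('k::comm_ring_1, 'p::ab_group_add, 'm::ab_group_add) jordan_data
    \<Rightarrow> ('p, 'm) tkk set" where
  "lie J = UNIV \<times> lie0 J \<times> UNIV"

definition lie_scale :: "('k, 'p, 'm) jordan_data \<Rightarrow> 'k \<Rightarrow> ('p, 'm) tkk \<Rightarrow> ('p, 'm) tkk" where
  "lie_scale J r = (\<lambda>(x, A, y). (scale_p J r x, scale_0 J r A, scale_m J r y))"

fun lie_bracket :: "('k, 'p::ab_group_add, 'm::ab_group_add) jordan_data
    \<Rightarrow> ('p, 'm) tkk \<Rightarrow> ('p, 'm) tkk \<Rightarrow> ('p, 'm) tkk" where
  "lie_bracket J (x, (A, A'), y) (u, (C, C'), v) =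
     (A u - C x,
      ((A \<circ> C) - (C \<circ> A), (A' \<circ> C') - (C' \<circ> A')) + inner_der J x v - inner_der J u y,
      A' v - C' y)"

definition grade_p :: "('p::zero, 'm::zero) tkk set" where
  "grade_p = {(x, 0, 0) | x. True}"

definition grade_0 :: "('k::comm_ring_1, 'p::ab_group_add, 'm::ab_group_add) jordan_data
    \<Rightarrow> ('p, 'm) tkk set" where
  "grade_0 J = {(0, A, 0) | A. A \<in> lie0 J}"

definition grade_m :: "('p::zero, 'm::zero) tkk set" where
  "grade_m = {(0, 0, y) | y. True}"

text \<open>
  The exponential series of \<open>ad X\<close> for \<open>X \<in> \<gg>\<^sub>\<plusminus>\<^sub>1\<close>: since \<open>ad X\<close> shifts the grading by \<open>\<plusminus>1\<close>,
  \<open>(ad X)\<^sup>3 = 0\<close>.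
\<close>

definition exp_ad :: "('k::comm_ring_1, 'p::ab_group_add, 'm::ab_group_add) jordan_data
    \<Rightarrow> ('p, 'm) tkk \<Rightarrow> ('p, 'm) tkk \<Rightarrow> ('p, 'm) tkk" where
  "exp_ad J X = (\<lambda>Z\<in>lie J.
     Z + lie_bracket J X Z + lie_scale J (ring_inv 2) (lie_bracket J X (lie_bracket J X Z)))"

definition exp_p :: "('k::comm_ring_1, 'p::ab_group_add, 'm::ab_group_add) jordan_data
    \<Rightarrow> 'p \<Rightarrow> ('p, 'm) tkk \<Rightarrow> ('p, 'm) tkk" where
  "exp_p J x = exp_ad J (x, 0, 0)"

definition exp_m :: "('k::comm_ring_1, 'p::ab_group_add, 'm::ab_group_add) jordan_data
    \<Rightarrow> 'm \<Rightarrow> ('p, 'm) tkk \<Rightarrow> ('p, 'm) tkk" where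
  "exp_m J y = exp_ad J (0, 0, y)"


section \<open>The associated geometry\<close>

type_synonym ('p, 'm) point = "(('p, 'm) tkk \<Rightarrow> ('p, 'm) tkk) set"

definition U_p :: "('k::comm_ring_1, 'p::ab_group_add, 'm::ab_group_add) jordan_data
    \<Rightarrow> (('p, 'm) tkk \<Rightarrow> ('p, 'm) tkk) set" where
  "U_p J = range (exp_p J)"

definition U_m :: "('k::comm_ring_1, 'p::ab_group_add, 'm::ab_group_add) jordan_data
    \<Rightarrow> (('p, 'm) tkk \<Rightarrow> ('p, 'm) tkk) set" where
  "U_m J = range (exp_m J)"

definition proj_group :: "('k::comm_ring_1, 'p::ab_group_add, 'm::ab_group_add) jordan_data
    \<Rightarrow> (('p, 'm) tkk \<Rightarrow> ('p, 'm) tkk) monoid" where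
  "proj_group J = subgroup_generated (BijGroup (lie J)) (U_p J \<union> U_m J)"

definition H_grp :: "('k::comm_ring_1, 'p::ab_group_add, 'm::ab_group_add) jordan_data
    \<Rightarrow> (('p, 'm) tkk \<Rightarrow> ('p, 'm) tkk) set" where
  "H_grp J = {h \<in> carrier (proj_group J).
     h ` grade_p = grade_p \<and> h ` grade_0 J = grade_0 J \<and> h ` grade_m = grade_m}"

definition P_p :: "('k::comm_ring_1, 'p::ab_group_add, 'm::ab_group_add) jordan_data
    \<Rightarrow> (('p, 'm) tkk \<Rightarrow> ('p, 'm) tkk) set" where
  "P_p J = U_p J <#>\<^bsub>proj_group J\<^esub> H_grp J"

definition P_m :: "('k::comm_ring_1, 'p::ab_group_add, 'm::ab_group_add) jordan_data
    \<Rightarrow> (('p, 'm) tkk \<Rightarrow> ('p, 'm) tkk) set" where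
  "P_m J = U_m J <#>\<^bsub>proj_group J\<^esub> H_grp J"

definition X_p :: "('k::comm_ring_1, 'p::ab_group_add, 'm::ab_group_add) jordan_data
    \<Rightarrow> ('p, 'm) point set" where
  "X_p J = lcosets\<^bsub>proj_group J\<^esub> (P_m J)"

definition X_m :: "('k::comm_ring_1, 'p::ab_group_add, 'm::ab_group_add) jordan_data
    \<Rightarrow> ('p, 'm) point set" where
  "X_m J = lcosets\<^bsub>proj_group J\<^esub> (P_p J)"

definition o_p :: "('k::comm_ring_1, 'p::ab_group_add, 'm::ab_group_add) jordan_data
    \<Rightarrow> ('p, 'm) point" where
  "o_p J = \<one>\<^bsub>proj_group J\<^esub> <#\<^bsub>proj_group J\<^esub> P_m J"

definition o_m :: "('k::comm_ring_1, 'p::ab_group_add, 'm::ab_group_add) jordan_data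
    \<Rightarrow> ('p, 'm) point" where
  "o_m J = \<one>\<^bsub>proj_group J\<^esub> <#\<^bsub>proj_group J\<^esub> P_p J"

definition act :: "('k::comm_ring_1, 'p::ab_group_add, 'm::ab_group_add) jordan_data
    \<Rightarrow> (('p, 'm) tkk \<Rightarrow> ('p, 'm) tkk) \<Rightarrow> ('p, 'm) point \<Rightarrow> ('p, 'm) point" where
  "act J g x = g <#\<^bsub>proj_group J\<^esub> x"

definition transversal :: "('k::comm_ring_1, 'p::ab_group_add, 'm::ab_group_add) jordan_data
    \<Rightarrow> ('p, 'm) point \<Rightarrow> ('p, 'm) point \<Rightarrow> bool" where
  "transversal J x a \<longleftrightarrow>
     (\<exists>g\<in>carrier (proj_group J). x = act J g (o_p J) \<and> a = act J g (o_m J))"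

definition v_of_m :: "('k::comm_ring_1, 'p::ab_group_add, 'm::ab_group_add) jordan_data
    \<Rightarrow> ('p, 'm) point \<Rightarrow> ('p, 'm) point set" where
  "v_of_m J a = {x \<in> X_p J. transversal J x a}"

definition v_of_p :: "('k::comm_ring_1, 'p::ab_group_add, 'm::ab_group_add) jordan_data
    \<Rightarrow> ('p, 'm) point \<Rightarrow> ('p, 'm) point set" where
  "v_of_p J x = {a \<in> X_m J. transversal J x a}"

text \<open>
  The charts \<open>V\<^sup>+ \<rightarrow> \<vv>\<^sub>g\<^sub>.\<^sub>o\<^sub>-\<close> and \<open>V\<^sup>- \<rightarrow> \<vv>\<^sub>g\<^sub>.\<^sub>o\<^sub>+\<close> obtained by transport with \<open>g\<close>. They are also the
  identifications of \<open>(V\<^sup>+, V\<^sup>-)\<close> with the Jordan pair of the base point \<open>(g.o\<^sup>+, g.o\<^sup>-)\<close>.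
  Mind the sign in \<open>chart_m\<close>.
\<close>

definition chart_p :: "('k::comm_ring_1, 'p::ab_group_add, 'm::ab_group_add) jordan_data
    \<Rightarrow> (('p, 'm) tkk \<Rightarrow> ('p, 'm) tkk) \<Rightarrow> 'p \<Rightarrow> ('p, 'm) point" where
  "chart_p J g u = act J g (act J (exp_p J u) (o_p J))"

definition chart_m :: "('k::comm_ring_1, 'p::ab_group_add, 'm::ab_group_add) jordan_data
    \<Rightarrow> (('p, 'm) tkk \<Rightarrow> ('p, 'm) tkk) \<Rightarrow> 'm \<Rightarrow> ('p, 'm) point" where
  "chart_m J g w = act J g (act J (exp_m J (- w)) (o_m J))"

text \<open>
  \<open>\<Pi>\<^sub>r(x,a,y)\<close> for \<open>x, y \<in> \<vv>\<^sub>a\<close>, and dually \<open>\<Pi>\<^sub>r(a,x,b)\<close> for \<open>a, b \<in> \<vv>\<^sub>x\<close>, computed in any chart.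
\<close>

definition Pi_p :: "('k::comm_ring_1, 'p::ab_group_add, 'm::ab_group_add) jordan_data
    \<Rightarrow> 'k \<Rightarrow> ('p, 'm) point \<Rightarrow> ('p, 'm) point \<Rightarrow> ('p, 'm) point \<Rightarrow> ('p, 'm) point" where
  "Pi_p J r x a y = (THE z. \<exists>g\<in>carrier (proj_group J). \<exists>u v.
     a = act J g (o_m J) \<and> x = chart_p J g u \<and> y = chart_p J g v \<and>
     z = chart_p J g (scale_p J (1 - r) u + scale_p J r v))"

definition Pi_m :: "('k::comm_ring_1, 'p::ab_group_add, 'm::ab_group_add) jordan_data
    \<Rightarrow> 'k \<Rightarrow> ('p, 'm) point \<Rightarrow> ('p, 'm) point \<Rightarrow> ('p, 'm) point \<Rightarrow> ('p, 'm) point" where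
  "Pi_m J r a x b = (THE c. \<exists>g\<in>carrier (proj_group J). \<exists>u v.
     x = act J g (o_p J) \<and> a = chart_m J g u \<and> b = chart_m J g v \<and>
     c = chart_m J g (scale_m J (1 - r) u + scale_m J r v))"

text \<open>
  For invertible \<open>r\<close>, \<open>grade_dil J r\<close> is the automorphism \<open>r, 1, r\<^sup>-\<^sup>1\<close> of the graded Lie algebra.
  Conjugation by it maps \<open>exp(u)\<close> to \<open>exp(r u)\<close> for \<open>u \<in> \<gg>\<^sub>1\<close> and to \<open>exp(r\<^sup>-\<^sup>1 u)\<close> for \<open>u \<in> \<gg>\<^sub>-\<^sub>1\<close>, hence
  preserves \<open>G\<close>, \<open>P\<^sup>+\<close> and \<open>P\<^sup>-\<close> and acts on cosets by \<open>coset_dil\<close>. On \<open>\<X>\<^sup>+\<close> this action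
  extends \<open>\<Pi>\<^sub>r(o\<^sup>+, o\<^sup>-, _)\<close>, the dilation \<open>r id\<close> of \<open>V\<^sup>+\<close>; transporting it by \<open>g\<close> gives the
  extension \<open>Pi_p_ext\<close> of \<open>\<Pi>\<^sub>r(x, a, _)\<close> to all of \<open>\<X>\<^sup>+\<close>.
\<close>

definition grade_dil :: "('k::comm_ring_1, 'p::ab_group_add, 'm::ab_group_add) jordan_data
    \<Rightarrow> 'k \<Rightarrow> ('p, 'm) tkk \<Rightarrow> ('p, 'm) tkk" where
  "grade_dil J r = (\<lambda>(x, A, y)\<in>lie J. (scale_p J r x, A, scale_m J (ring_inv r) y))"

definition coset_dil :: "('k::comm_ring_1, 'p::ab_group_add, 'm::ab_group_add) jordan_data
    \<Rightarrow> 'k \<Rightarrow> ('p, 'm) point \<Rightarrow> ('p, 'm) point" where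
  "coset_dil J r C =
     (\<lambda>k. grade_dil J r \<otimes>\<^bsub>BijGroup (lie J)\<^esub> k \<otimes>\<^bsub>BijGroup (lie J)\<^esub>
          inv\<^bsub>BijGroup (lie J)\<^esub> (grade_dil J r)) ` C"

definition Pi_p_ext :: "('k::comm_ring_1, 'p::ab_group_add, 'm::ab_group_add) jordan_data
    \<Rightarrow> 'k \<Rightarrow> ('p, 'm) point \<Rightarrow> ('p, 'm) point \<Rightarrow> ('p, 'm) point \<Rightarrow> ('p, 'm) point" where
  "Pi_p_ext J r x a y = (THE z. \<exists>g\<in>carrier (proj_group J).
     x = act J g (o_p J) \<and> a = act J g (o_m J) \<and>
     z = act J g (coset_dil J r (act J (inv\<^bsub>proj_group J\<^esub> g) y)))"


section \<open>The symmetric space \<open>\<U>\<^sub>a\<^sub>,\<^sub>b\<close>\<close>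

definition U_ab :: "('k::comm_ring_1, 'p::ab_group_add, 'm::ab_group_add) jordan_data
    \<Rightarrow> ('p, 'm) point \<Rightarrow> ('p, 'm) point \<Rightarrow> ('p, 'm) point set" where
  "U_ab J a b = v_of_m J a \<inter> v_of_m J b"

definition mu :: "('k::comm_ring_1, 'p::ab_group_add, 'm::ab_group_add) jordan_data
    \<Rightarrow> ('p, 'm) point \<Rightarrow> ('p, 'm) point \<Rightarrow> ('p, 'm) point \<Rightarrow> ('p, 'm) point \<Rightarrow> ('p, 'm) point" where
  "mu J a b x y = Pi_p_ext J (-1) x (Pi_m J (ring_inv 2) a x b) y"

definition U_chart :: "('k::comm_ring_1, 'p::ab_group_add, 'm::ab_group_add) jordan_data
    \<Rightarrow> 'm \<Rightarrow> 'p set" where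
  "U_chart J a = {x. Bergman J x (- a) \<in> GL_p J}"

definition quad_map :: "('k::comm_ring_1, 'p::ab_group_add, 'm::ab_group_add) jordan_data
    \<Rightarrow> 'm \<Rightarrow> 'p \<Rightarrow> 'p \<Rightarrow> 'p" where
  "quad_map J a x = translation (scale_p J 2 x + Qp J x a) \<circ> Bergman J x (- a)"

definition sigma_0 :: "('k::comm_ring_1, 'p::ab_group_add, 'm::ab_group_add) jordan_data
    \<Rightarrow> 'm \<Rightarrow> 'p \<Rightarrow> 'p" where
  "sigma_0 J a y = - quasi_inverse J (- a) y"


section \<open>Consistency of the definitions\<close>

text \<open>
  The elements of \<open>G\<close> are automorphisms of the Lie algebra, \<open>\<Pi>\<^sub>r\<close> does not depend on the chart
  (\<open>Pi_p_chart\<close>), the map \<open>Pi_p_ext\<close> does not depend on \<open>g\<close> (\<open>Pi_p_ext_eq\<close>), and it extends \<open>\<Pi>\<^sub>r\<close>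
  (\<open>Pi_p_ext_extends\<close>).
\<close>

lemma ring_inv: assumes "r dvd 1" shows "r * ring_inv r = (1::'k::comm_ring_1)"
proof -
  obtain s where s: "r * s = 1" using assms by (metis dvd_def)
  have "t = s" if "r * t = 1" for t
  proof -
    have "t = t * (r * s)" using s by simp
    also have "\<dots> = s * (r * t)" by (simp add: mult_ac)
    finally show ?thesis using that by simp
  qed
  with s have "ring_inv r = s" unfolding ring_inv_def by (intro the_equality)
  then show ?thesis using s by simp
qed

context jordan_pair begin

sublocale p: module "scale_p J" by (rule module_p)
sublocale m: module "scale_m J" by (rule module_m)

abbreviation half where "half \<equiv> ring_inv (2::'k)"

lemma half: "half + half = 1" "2 * half = 1"
  using ring_inv[OF two_invertible] by simp_all

lemma half_p: "scale_p J half x + scale_p J half x = x"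
  by (simp flip: p.scale_left_distrib add: half)
lemma half_m: "scale_m J half x + scale_m J half x = x"
  by (simp flip: m.scale_left_distrib add: half)

lemmas Tlin = Tp_linear1[THEN module_hom.add] Tp_linear2[THEN module_hom.add] Tp_linear3[THEN module_hom.add]
  Tm_linear1[THEN module_hom.add] Tm_linear2[THEN module_hom.add] Tm_linear3[THEN module_hom.add]
  Tp_linear1[THEN module_hom.scale] Tp_linear2[THEN module_hom.scale] Tp_linear3[THEN module_hom.scale]
  Tm_linear1[THEN module_hom.scale] Tm_linear2[THEN module_hom.scale] Tm_linear3[THEN module_hom.scale]
  Tp_linear1[THEN module_hom.zero] Tp_linear2[THEN module_hom.zero] Tp_linear3[THEN module_hom.zero]
  Tm_linear1[THEN module_hom.zero] Tm_linear2[THEN module_hom.zero] Tm_linear3[THEN module_hom.zero]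
  Tp_linear1[THEN module_hom.neg] Tp_linear2[THEN module_hom.neg] Tp_linear3[THEN module_hom.neg]
  Tm_linear1[THEN module_hom.neg] Tm_linear2[THEN module_hom.neg] Tm_linear3[THEN module_hom.neg]
  Tp_linear1[THEN module_hom.diff] Tp_linear2[THEN module_hom.diff] Tp_linear3[THEN module_hom.diff]
  Tm_linear1[THEN module_hom.diff] Tm_linear2[THEN module_hom.diff] Tm_linear3[THEN module_hom.diff]

sublocale z: module "scale_0 J"
  by unfold_locales
    (auto simp: scale_0_def fun_eq_iff prod_eq_iff p.scale_right_distrib m.scale_right_distrib
      p.scale_left_distrib m.scale_left_distrib)

definition der :: "('p \<Rightarrow> 'p) \<times> ('m \<Rightarrow> 'm) \<Rightarrow> bool" where
  "der C \<longleftrightarrow> (\<forall>x y. fst C (x + y) = fst C x + fst C y) \<and> (\<forall>r x. fst C (scale_p J r x) = scale_p J r (fst C x)) \<and>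
   (\<forall>x y. snd C (x + y) = snd C x + snd C y) \<and> (\<forall>r x. snd C (scale_m J r x) = scale_m J r (snd C x)) \<and>
   (\<forall>x y z. fst C (Tp J x y z) = Tp J (fst C x) y z + Tp J x (snd C y) z + Tp J x y (fst C z)) \<and>
   (\<forall>x y z. snd C (Tm J x y z) = Tm J (snd C x) y z + Tm J x (fst C y) z + Tm J x y (snd C z))"

lemma lie0_der: "C \<in> lie0 J \<Longrightarrow> der C"
  unfolding lie0_def
proof (induction rule: z.span_induct_alt)
  case base
  show ?case by (simp add: der_def Tlin)
next
  case (step c x y)
  have "der (inner_der J u v)" for u v
    unfolding der_def inner_der_def fst_conv snd_conv
    apply (intro conjI allI)
    subgoal by (simp add: Tlin)
    subgoal by (simp add: Tlin)
    subgoal by (simp add: Tlin)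
    subgoal by (simp add: Tlin)
    subgoal for x y z by (subst Tp_jordan) (simp add: Tlin)
    subgoal for x y z by (subst Tm_jordan) (simp add: Tlin)
    done
  moreover have "der (\<lambda>z. z, \<lambda>z. - z)" by (simp add: der_def Tlin)
  ultimately have "der x" using step by auto
  with step show ?case
    by (simp add: der_def Tlin scale_0_def p.scale_right_distrib m.scale_right_distrib add_ac mult_ac)
qed

lemma inner_lie0: "inner_der J x y \<in> lie0 J"
  unfolding lie0_def by (rule z.span_base) auto

lemma zero_lie0[simp]: "0 \<in> lie0 J" unfolding lie0_def by (rule z.span_zero)

lemma lie0_ops: "A \<in> lie0 J \<Longrightarrow> C \<in> lie0 J \<Longrightarrow> A + C \<in> lie0 J"
  "A \<in> lie0 J \<Longrightarrow> C \<in> lie0 J \<Longrightarrow> A - C \<in> lie0 J"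
  "A \<in> lie0 J \<Longrightarrow> - A \<in> lie0 J"
  "A \<in> lie0 J \<Longrightarrow> scale_0 J r A \<in> lie0 J"
  unfolding lie0_def by (auto intro: z.span_add z.span_diff z.span_neg z.span_scale)

lemma lie_iff: "X \<in> lie J \<longleftrightarrow> fst (snd X) \<in> lie0 J"
  by (cases X) (simp add: lie_def)

lemma lie_ops: "A \<in> lie J \<Longrightarrow> C \<in> lie J \<Longrightarrow> A + C \<in> lie J"
  "A \<in> lie J \<Longrightarrow> C \<in> lie J \<Longrightarrow> A - C \<in> lie J"
  "A \<in> lie J \<Longrightarrow> - A \<in> lie J"
  "A \<in> lie J \<Longrightarrow> lie_scale J r A \<in> lie J"
  unfolding lie_iff by (simp_all add: lie0_ops lie_scale_def split_def)

lemma der_derI: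
  assumes "der (A,A')"
  shows "A (x+y) = A x + A y" "A' (u+v) = A' u + A' v" "A (x-y) = A x - A y" "A' (u-v) = A' u - A' v" 
   "A (-x) = - A x" "A' (-u) = - A' u" "A 0 = 0" "A' 0 = 0"
   "A (scale_p J r x) = scale_p J r (A x)" "A' (scale_m J r u) = scale_m J r (A' u)"
   "A (Tp J x u y) = Tp J (A x) u y + Tp J x (A' u) y + Tp J x u (A y)"
   "A' (Tm J u x v) = Tm J (A' u) x v + Tm J u (A x) v + Tm J u x (A' v)"
proof -
  have ap: "\<And>x y. A (x+y) = A x + A y" and am: "\<And>x y. A' (x+y) = A' x + A' y"
    using assms by (auto simp: der_def)
  have z: "A 0 = 0" "A' 0 = 0" using ap[of 0 0] am[of 0 0] by auto
  have n: "A (-x) = - A x" "A' (-u) = - A' u" for x u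
    using ap[of x "-x"] am[of u "-u"] z by (simp_all add: eq_neg_iff_add_eq_0 add.commute)
  show "A (x-y) = A x - A y" "A' (u-v) = A' u - A' v"
    using ap[of x "-y"] am[of u "-v"] n by auto
  show "A (x+y) = A x + A y" "A' (u+v) = A' u + A' v" "A (-x) = - A x" "A' (-u) = - A' u" "A 0 = 0" "A' 0 = 0"
    by (fact ap am n z)+
qed (use assms in \<open>simp_all add: der_def\<close>)

lemma comm_inner: assumes "der (A,A')"
  shows "((A \<circ> (\<lambda>z. Tp J x y z)) - ((\<lambda>z. Tp J x y z) \<circ> A), (A' \<circ> (\<lambda>z. - Tm J y x z)) - ((\<lambda>z. - Tm J y x z) \<circ> A'))
     = inner_der J (A x) y + inner_der J x (A' y)"
proof -
  have "A' (- w) = - A' w" for w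
    using der_derI[OF assms] by simp
  then show ?thesis using assms by (auto simp: der_def inner_der_def fun_eq_iff)
qed

lemma comm_lie0:
  assumes A: "A \<in> lie0 J" and C: "C \<in> lie0 J"
  shows "((fst A \<circ> fst C) - (fst C \<circ> fst A), (snd A \<circ> snd C) - (snd C \<circ> snd A)) \<in> lie0 J"
  using C unfolding lie0_def
proof (induction rule: z.span_induct_alt)
  case base
  have "der A" using A by (rule lie0_der)
  then have "fst A 0 = 0" "snd A 0 = 0" using der_derI[of "fst A" "snd A"] by simp_all
  then have "((fst A \<circ> fst (0::('p\<Rightarrow>'p)\<times>('m\<Rightarrow>'m))) - (fst (0::('p\<Rightarrow>'p)\<times>('m\<Rightarrow>'m)) \<circ> fst A), (snd A \<circ> snd (0::('p\<Rightarrow>'p)\<times>('m\<Rightarrow>'m))) - (snd (0::('p\<Rightarrow>'p)\<times>('m\<Rightarrow>'m)) \<circ> snd A)) = 0"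
    by (auto simp: fun_eq_iff prod_eq_iff)
  then show ?case using z.span_zero by (simp only:)
next
  case (step c x y)
  have dA: "der A" using A by (rule lie0_der)
  have nA: "snd A (- w) = - snd A w" for w
    using der_derI[of "fst A" "snd A"] dA by simp
  have "((fst A \<circ> fst x) - (fst x \<circ> fst A), (snd A \<circ> snd x) - (snd x \<circ> snd A)) \<in> lie0 J" (is "?K \<in> _")
  proof (cases "x = (\<lambda>z. z, \<lambda>z. - z)")
    case True
    then have "?K = 0" using nA by (auto simp: fun_eq_iff prod_eq_iff)
    then show ?thesis by simp
  next
    case False
    then obtain u v where "x = inner_der J u v" using step by auto
    then have "?K = inner_der J (fst A u) v + inner_der J u (snd A v)"
      using comm_inner[of "fst A" "snd A" u v] dA by (simp add: inner_der_def)
    then show ?thesis by (simp add: inner_lie0 lie0_ops)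
  qed
  then have "scale_0 J c ?K + ((fst A \<circ> fst y) - (fst y \<circ> fst A), (snd A \<circ> snd y) - (snd y \<circ> snd A)) \<in> lie0 J"
    using step(2)[folded lie0_def] by (intro lie0_ops)
  also have "scale_0 J c ?K + ((fst A \<circ> fst y) - (fst y \<circ> fst A), (snd A \<circ> snd y) - (snd y \<circ> snd A))
    = ((fst A \<circ> fst (scale_0 J c x + y)) - (fst (scale_0 J c x + y) \<circ> fst A), 
       (snd A \<circ> snd (scale_0 J c x + y)) - (snd (scale_0 J c x + y) \<circ> snd A))"
    using dA by (auto simp: der_def scale_0_def fun_eq_iff p.scale_right_diff_distrib m.scale_right_diff_distrib)
  finally show ?case unfolding lie0_def .
qed

lemma lie_bracket_closed: assumes "X \<in> lie J" "Y \<in> lie J" shows "lie_bracket J X Y \<in> lie J"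
proof -
  obtain x A A' y where X: "X = (x,(A,A'),y)" by (cases X) auto
  obtain u C C' v where Y: "Y = (u,(C,C'),v)" by (cases Y) auto
  have "((A \<circ> C) - (C \<circ> A), (A' \<circ> C') - (C' \<circ> A')) \<in> lie0 J"
    using comm_lie0[of "(A,A')" "(C,C')"] assms X Y by (simp add: lie_iff)
  then show ?thesis unfolding X Y lie_bracket.simps lie_iff snd_conv fst_conv
    by (intro lie0_ops inner_lie0)
qed

definition sml :: "('p,'m) tkk \<Rightarrow> bool" where "sml X \<longleftrightarrow> X \<in> range (\<lambda>x::'p. (x,0,0::'m)) \<union> range (\<lambda>y. (0::'p,0,y))"

lemma jacobi_sml:
  assumes "sml X" "Y \<in> lie J" "Z \<in> lie J"
  shows "lie_bracket J X (lie_bracket J Y Z) = 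
    lie_bracket J (lie_bracket J X Y) Z + lie_bracket J Y (lie_bracket J X Z)"
proof -
  obtain u C C' v where Y: "Y = (u,(C,C'),v)" by (cases Y) auto
  obtain u2 F F' v2 where Z: "Z = (u2,(F,F'),v2)" by (cases Z) auto
  have dC: "der (C,C')" "der (F,F')" using assms Y Z lie0_der by (auto simp: lie_def)
  note d = der_derI[OF dC(1)] der_derI[OF dC(2)]
  from assms(1) consider (1) x where "X = (x,0,0)" | (2) y where "X = (0,0,y)" by (auto simp: sml_def)
  then show ?thesis
  proof cases
    case 1
    show ?thesis unfolding 1 Y Z zero_prod_def
      using Tp_sym Tm_sym 
      by (auto simp: inner_der_def fun_eq_iff prod_eq_iff Tlin d algebra_simps)
  next
    case 2
    show ?thesis unfolding 2 Y Z zero_prod_def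
      using Tp_sym Tm_sym 
      by (auto simp: inner_der_def fun_eq_iff prod_eq_iff Tlin d algebra_simps)
  qed
qed


lemma sml_lie: "sml X \<Longrightarrow> X \<in> lie J" by (auto simp: sml_def lie_iff)

lemma br_bilin:
  assumes "X \<in> lie J" "Y \<in> lie J" "Z \<in> lie J"
  shows "lie_bracket J X (Y + Z) = lie_bracket J X Y + lie_bracket J X Z"
    "lie_bracket J (Y + Z) X = lie_bracket J Y X + lie_bracket J Z X"
    "lie_bracket J X (lie_scale J r Y) = lie_scale J r (lie_bracket J X Y)"
    "lie_bracket J (lie_scale J r Y) X = lie_scale J r (lie_bracket J Y X)"
    "lie_bracket J (- Y) X = - lie_bracket J Y X"
proof -
  obtain x A A' y where X: "X = (x,(A,A'),y)" by (cases X) auto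
  obtain u C C' v where Y: "Y = (u,(C,C'),v)" by (cases Y) auto
  obtain u2 F F' v2 where Z: "Z = (u2,(F,F'),v2)" by (cases Z) auto
  have dC: "der (A,A')" "der (C,C')" "der (F,F')" using assms X Y Z lie0_der by (auto simp: lie_def)
  note d = der_derI[OF dC(1)] der_derI[OF dC(2)] der_derI[OF dC(3)]
  note e = inner_der_def fun_eq_iff prod_eq_iff Tlin d lie_scale_def scale_0_def p.scale_right_diff_distrib p.scale_right_distrib
    m.scale_right_diff_distrib m.scale_right_distrib
  show "lie_bracket J X (Y + Z) = lie_bracket J X Y + lie_bracket J X Z"
    "lie_bracket J (Y + Z) X = lie_bracket J Y X + lie_bracket J Z X"
    "lie_bracket J X (lie_scale J r Y) = lie_scale J r (lie_bracket J X Y)"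
    "lie_bracket J (lie_scale J r Y) X = lie_scale J r (lie_bracket J Y X)"
    "lie_bracket J (- Y) X = - lie_bracket J Y X"
    unfolding X Y Z by (simp_all add: e)
qed

sublocale l: module "lie_scale J"
  by unfold_locales
    (auto simp: lie_scale_def prod_eq_iff p.scale_right_distrib m.scale_right_distrib
      p.scale_left_distrib m.scale_left_distrib z.scale_right_distrib z.scale_left_distrib split_def)

lemma sml_nil:
  assumes "sml X" "Y \<in> lie J"
  shows "lie_bracket J X (lie_bracket J X (lie_bracket J X Y)) = 0"
proof -
  obtain u C C' v where Y: "Y = (u,(C,C'),v)" by (cases Y) auto
  have "der (C,C')" using assms Y lie0_der by (auto simp: lie_def)
  note d = der_derI[OF this]
  from assms(1) consider (1) x where "X = (x,0,0)" | (2) y where "X = (0,0,y)" by (auto simp: sml_def)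
  then show ?thesis
  proof cases
    case 1 show ?thesis unfolding 1 Y zero_prod_def by (auto simp: inner_der_def fun_eq_iff prod_eq_iff Tlin d)
  next
    case 2 show ?thesis unfolding 2 Y zero_prod_def by (auto simp: inner_der_def fun_eq_iff prod_eq_iff Tlin d)
  qed
qed

lemma sml_nil2:
  assumes "sml X" "Y \<in> lie J" "Z \<in> lie J"
  shows "lie_bracket J (lie_bracket J X (lie_bracket J X Y)) (lie_bracket J X (lie_bracket J X Z)) = 0"
proof -
  obtain u C C' v where Y: "Y = (u,(C,C'),v)" by (cases Y) auto
  obtain u2 F F' v2 where Z: "Z = (u2,(F,F'),v2)" by (cases Z) auto
  have dC: "der (C,C')" "der (F,F')" using assms Y Z lie0_der by (auto simp: lie_def)
  note d = der_derI[OF dC(1)] der_derI[OF dC(2)]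
  from assms(1) consider (1) x where "X = (x,0,0)" | (2) y where "X = (0,0,y)" by (auto simp: sml_def)
  then show ?thesis
  proof cases
    case 1 show ?thesis unfolding 1 Y Z zero_prod_def by (auto simp: inner_der_def fun_eq_iff prod_eq_iff Tlin d)
  next
    case 2 show ?thesis unfolding 2 Y Z zero_prod_def by (auto simp: inner_der_def fun_eq_iff prod_eq_iff Tlin d)
  qed
qed

lemma three_zero: "W + W + W = 0 \<Longrightarrow> W = (0::('p,'m) tkk)"
proof -
  assume W: "W + W + W = 0"
  have "W = lie_scale J (ring_inv 3 * 3) W" using ring_inv[OF three_invertible] by (simp add: mult.commute)
  also have "\<dots> = lie_scale J (ring_inv 3) (lie_scale J (1+1+1) W)" by simp
  also have "\<dots> = lie_scale J (ring_inv 3) (W + W + W)"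
    by (simp only: l.scale_left_distrib l.scale_one)
  finally show ?thesis using W by simp
qed

lemma exp_lie: "sml X \<Longrightarrow> Z \<in> lie J \<Longrightarrow> exp_ad J X Z \<in> lie J"
  unfolding exp_ad_def by (simp add: lie_ops lie_bracket_closed sml_lie)

lemma sml_neg: assumes "sml X" shows "sml (- X)"
proof -
  from assms consider (1) x where "X = (x,0,0)" | (2) y where "X = (0,0,y)" by (auto simp: sml_def)
  then show ?thesis
    by cases (auto simp: sml_def image_iff prod_eq_iff)
qed

lemma br0: "X \<in> lie J \<Longrightarrow> lie_bracket J X 0 = 0" 
  using br_bilin(3)[of X 0 0 0] by (simp add: lie_iff)

lemma zbr: "X \<in> lie J \<Longrightarrow> lie_bracket J 0 X = 0" 
  using br_bilin(4)[of X 0 0 0] by (simp add: lie_iff)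

lemma l_half: "lie_scale J half X + lie_scale J half X = X"
  by (simp flip: l.scale_left_distrib add: half)

lemma exp_inv: assumes X: "sml X" and Z: "Z \<in> lie J" shows "exp_ad J (- X) (exp_ad J X Z) = Z"
proof -
  let ?D = "lie_bracket J X"
  have c: "?D Z \<in> lie J" "?D (?D Z) \<in> lie J" "X \<in> lie J" using X Z by (auto simp: lie_bracket_closed sml_lie)
  define E where "E = Z + ?D Z + lie_scale J half (?D (?D Z))"
  have E: "E \<in> lie J" unfolding E_def by (simp add: lie_ops c Z)
  have DE: "?D E = ?D Z + ?D (?D Z)"
    unfolding E_def using c Z X by (simp add: br_bilin lie_ops sml_nil)
  have DDE: "?D (?D E) = ?D (?D Z)"
    unfolding DE using c Z X by (simp add: br_bilin lie_ops sml_nil)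
  have "lie_bracket J (- X) E = - ?D E" using E c by (simp add: br_bilin)
  moreover have "lie_bracket J (- X) (- ?D E) = ?D (?D E)"
    using br_bilin(5)[of "- ?D E" X X] br_bilin(3)[of X "?D E" "?D E" "-1"] E c
    by (simp add: lie_ops lie_bracket_closed)
  ultimately have "exp_ad J (- X) E = E - (?D Z + ?D (?D Z)) + lie_scale J half (?D (?D Z))"
    unfolding exp_ad_def using E DE DDE by simp
  also have "\<dots> = Z + (lie_scale J half (?D (?D Z)) + lie_scale J half (?D (?D Z))) - ?D (?D Z)"
    unfolding E_def by (simp add: algebra_simps)
  also have "\<dots> = Z" by (simp only: l_half) simp
  finally show ?thesis using Z unfolding E_def exp_ad_def by simp
qed

lemma exp_Bij: assumes X: "sml X" shows "exp_ad J X \<in> Bij (lie J)"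
proof -
  have "bij_betw (exp_ad J X) (lie J) (lie J)"
    by (rule bij_betw_byWitness[where f' = "exp_ad J (- X)"])
      (use exp_inv[OF X] exp_inv[OF sml_neg[OF X]] exp_lie[OF X] exp_lie[OF sml_neg[OF X]] in auto)
  then show ?thesis by (auto simp: Bij_def exp_ad_def)
qed

definition lieaut where
  "lieaut f \<longleftrightarrow> f \<in> Bij (lie J) \<and> (\<forall>X\<in>lie J. \<forall>Y\<in>lie J. f (X + Y) = f X + f Y) \<and>
     (\<forall>r. \<forall>X\<in>lie J. f (lie_scale J r X) = lie_scale J r (f X)) \<and>
     (\<forall>X\<in>lie J. \<forall>Y\<in>lie J. f (lie_bracket J X Y) = lie_bracket J (f X) (f Y))"

lemma exp_lieaut: assumes X: "sml X" shows "lieaut (exp_ad J X)"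
  unfolding lieaut_def
proof (intro conjI ballI allI)
  show "exp_ad J X \<in> Bij (lie J)" using X by (rule exp_Bij)
next
  fix Y Z assume YZ: "Y \<in> lie J" "Z \<in> lie J"
  then show "exp_ad J X (Y + Z) = exp_ad J X Y + exp_ad J X Z"
    using X by (simp add: exp_ad_def lie_ops br_bilin lie_bracket_closed sml_lie l.scale_right_distrib)
next
  fix Y r assume Y: "Y \<in> lie J"
  then show "exp_ad J X (lie_scale J r Y) = lie_scale J r (exp_ad J X Y)"
    using X by (simp add: exp_ad_def lie_ops br_bilin lie_bracket_closed sml_lie l.scale_right_distrib mult.commute)
next
  fix Y Z assume Y: "Y \<in> lie J" and Z: "Z \<in> lie J"
  let ?D = "lie_bracket J X" and ?b = "lie_bracket J" and ?h = "lie_scale J half"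
  have c: "X \<in> lie J" "?D Y \<in> lie J" "?D (?D Y) \<in> lie J" "?D Z \<in> lie J" "?D (?D Z) \<in> lie J"
    "?b Y Z \<in> lie J" using X Y Z by (auto simp: lie_bracket_closed sml_lie)
  note cl = c Y Z lie_ops lie_bracket_closed
  have jac: "?D (?b P Q) = ?b (?D P) Q + ?b P (?D Q)" if "P \<in> lie J" "Q \<in> lie J" for P Q
    using jacobi_sml[OF X that] .
  have d1: "?D (?b Y Z) = ?b (?D Y) Z + ?b Y (?D Z)" by (rule jac[OF Y Z])
  have s: "?D (P + Q) = ?D P + ?D Q" if "P \<in> lie J" "Q \<in> lie J" for P Q using br_bilin(1)[OF c(1) that] .
  note jj = jac[OF c(2) Z] jac[OF Y c(4)] jac[OF c(3) Z] jac[OF c(2) c(4)] jac[OF Y c(5)]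
  have d2: "?D (?D (?b Y Z)) = ?b (?D (?D Y)) Z + (?b (?D Y) (?D Z) + ?b (?D Y) (?D Z)) + ?b Y (?D (?D Z))"
    unfolding d1 using cl by (simp add: s jj add_ac)
  let ?W = "?b (?D (?D Y)) (?D Z) + ?b (?D Y) (?D (?D Z))"
  have "?D (?D (?D (?b Y Z))) = ?W + ?W + ?W"
    unfolding d2 using cl X Y Z by (simp add: s jj sml_nil br0 zbr add_ac)
  with sml_nil[OF X c(6)] have "?W + ?W + ?W = 0" by (simp only:)
  then have W: "?W = 0" by (rule three_zero)
  have hh: "?h (P + P) = P" for P using l_half[of P] by (simp add: l.scale_right_distrib)
  have "exp_ad J X (?b Y Z) = ?b Y Z + (?b (?D Y) Z + ?b Y (?D Z)) + (?h (?b (?D (?D Y)) Z) + ?b (?D Y) (?D Z) + ?h (?b Y (?D (?D Z))))"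
  proof -
    have "?h (?D (?D (?b Y Z))) = ?h (?b (?D (?D Y)) Z) + ?b (?D Y) (?D Z) + ?h (?b Y (?D (?D Z)))"
      unfolding d2 l.scale_right_distrib[of half "_ + (_ + _)"] l.scale_right_distrib[of half "?b (?D (?D Y)) Z"] hh ..
    then show ?thesis
      using c by (simp only: exp_ad_def restrict_apply' d1[symmetric])
  qed
  also have "\<dots> = \<dots> + ?h ?W + ?h (?h (?b (?D (?D Y)) (?D (?D Z))))"
    using W sml_nil2[OF X Y Z] by simp
  also have "\<dots> = ?b (Y + ?D Y + ?h (?D (?D Y))) (Z + ?D Z + ?h (?D (?D Z)))"
    using cl by (simp add: br_bilin l.scale_right_distrib add_ac)
  finally show "exp_ad J X (?b Y Z) = ?b (exp_ad J X Y) (exp_ad J X Z)"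
    using Y Z by (simp add: exp_ad_def)
qed


abbreviation "B \<equiv> BijGroup (lie J)"
abbreviation "G \<equiv> proj_group J"

sublocale BG: group B by (rule group_BijGroup)

lemma sml_pm[simp]: "sml (u,0,0)" "sml (0,0,w)" by (auto simp: sml_def)

lemma U_Bij: "U_p J \<union> U_m J \<subseteq> carrier B"
  using exp_Bij[OF sml_pm(1)] exp_Bij[OF sml_pm(2)] by (auto simp: U_p_def U_m_def exp_p_def exp_m_def BijGroup_def)

sublocale GG: group G unfolding proj_group_def by (rule BG.group_subgroup_generated)

lemma G_mult[simp]: "f \<otimes>\<^bsub>G\<^esub> k = f \<otimes>\<^bsub>B\<^esub> k" and G_one[simp]: "\<one>\<^bsub>G\<^esub> = \<one>\<^bsub>B\<^esub>"
  by (simp_all add: proj_group_def subgroup_generated_def)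

lemma G_carrier: "carrier G = generate B (U_p J \<union> U_m J)"
  using U_Bij by (simp add: proj_group_def subgroup_generated_def Int_absorb1)

lemma G_sub: "f \<in> carrier G \<Longrightarrow> f \<in> carrier B"
  using BG.generate_in_carrier[OF U_Bij] by (simp add: G_carrier)

lemma G_inv: "f \<in> carrier G \<Longrightarrow> inv\<^bsub>G\<^esub> f = inv\<^bsub>B\<^esub> f"
  unfolding proj_group_def by (rule BG.inv_subgroup_generated)

lemma carB: "carrier B = Bij (lie J)" by (simp add: BijGroup_def)

lemma B_app: "f \<in> carrier B \<Longrightarrow> k \<in> carrier B \<Longrightarrow> X \<in> lie J \<Longrightarrow> (f \<otimes>\<^bsub>B\<^esub> k) X = f (k X)"
  by (simp add: BijGroup_def compose_def)

lemma B_one: "X \<in> lie J \<Longrightarrow> \<one>\<^bsub>B\<^esub> X = X" by (simp add: BijGroup_def)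

lemma B_in: "f \<in> carrier B \<Longrightarrow> X \<in> lie J \<Longrightarrow> f X \<in> lie J"
  by (auto simp: carB Bij_def bij_betw_def)

lemma B_eqI: assumes "f \<in> carrier B" "k \<in> carrier B" "\<And>X. X \<in> lie J \<Longrightarrow> f X = k X" shows "f = k"
  using assms by (auto simp: carB Bij_def intro: extensionalityI)

lemma B_inv_app: assumes "f \<in> carrier B" "X \<in> lie J" shows "f ((inv\<^bsub>B\<^esub> f) X) = X" "(inv\<^bsub>B\<^esub> f) (f X) = X"
  using B_app[of f "inv\<^bsub>B\<^esub> f" X] B_app[of "inv\<^bsub>B\<^esub> f" f X] assms B_one by auto

lemma lieaut_mult: assumes "lieaut f" "lieaut k" shows "lieaut (f \<otimes>\<^bsub>B\<^esub> k)"
proof -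
  have c: "f \<in> carrier B" "k \<in> carrier B" using assms by (auto simp: lieaut_def carB)
  then have "f \<otimes>\<^bsub>B\<^esub> k \<in> Bij (lie J)" by (simp flip: carB)
  then show ?thesis using assms c unfolding lieaut_def
    by (simp add: B_app lie_ops lie_bracket_closed B_in)
qed

lemma lieaut_one: "lieaut \<one>\<^bsub>B\<^esub>"
  unfolding lieaut_def using BG.one_closed by (simp add: B_one lie_ops lie_bracket_closed carB)

lemma lieaut_inv: assumes "lieaut f" shows "lieaut (inv\<^bsub>B\<^esub> f)"
proof -
  have c: "f \<in> carrier B" using assms by (auto simp: lieaut_def carB)
  then have i: "inv\<^bsub>B\<^esub> f \<in> carrier B" by simp
  let ?i = "inv\<^bsub>B\<^esub> f"
  have e: "?i X = Y" if "X = f Y" "Y \<in> lie J" for X Y using that B_inv_app[OF c] by simp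
  show ?thesis unfolding lieaut_def
    using assms i by (auto simp: lieaut_def carB[symmetric] B_inv_app[OF c] B_in lie_ops lie_bracket_closed intro!: e)
qed

lemma G_lieaut: "f \<in> carrier G \<Longrightarrow> lieaut f"
  unfolding G_carrier
proof (induction rule: generate.induct)
  case one show ?case by (rule lieaut_one)
next
  case (incl h) then show ?case using exp_lieaut[OF sml_pm(1)] exp_lieaut[OF sml_pm(2)] by (auto simp: U_p_def U_m_def exp_p_def exp_m_def)
next
  case (inv h) then show ?case using exp_lieaut[OF sml_pm(1)] exp_lieaut[OF sml_pm(2)] lieaut_inv by (auto simp: U_p_def U_m_def exp_p_def exp_m_def)
next
  case (eng h1 h2) then show ?case by (simp add: lieaut_mult)
qed

lemma conj_exp:
  assumes f: "lieaut f" and X: "sml X" "sml (f X)"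
  shows "f \<otimes>\<^bsub>B\<^esub> exp_ad J X = exp_ad J (f X) \<otimes>\<^bsub>B\<^esub> f"
proof -
  have c: "f \<in> carrier B" "exp_ad J X \<in> carrier B" "exp_ad J (f X) \<in> carrier B"
    using f X exp_Bij by (auto simp: lieaut_def carB)
  show ?thesis
  proof (rule B_eqI)
    fix Z assume Z: "Z \<in> lie J"
    have "f (exp_ad J X Z) = exp_ad J (f X) (f Z)"
      using f Z X unfolding lieaut_def exp_ad_def
      by (simp add: lie_ops lie_bracket_closed sml_lie B_in c)
    then show "(f \<otimes>\<^bsub>B\<^esub> exp_ad J X) Z = (exp_ad J (f X) \<otimes>\<^bsub>B\<^esub> f) Z"
      using Z c by (simp add: B_app)
  qed (use c in auto)
qed

lemma exp_car: "exp_p J u \<in> carrier G" "exp_m J w \<in> carrier G"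
  unfolding G_carrier by (auto simp: U_p_def U_m_def intro: generate.incl)

lemma exp_val:
  assumes "(C,C') \<in> lie0 J"
  shows "exp_p J x (u,(C,C'),v) = (u - C x - scale_p J half (Tp J x v x), (C,C') + inner_der J x v, v)"
   and "exp_m J y (u,(C,C'),v) = (u, (C,C') - inner_der J u y, v - C' y - scale_m J half (Tm J y u y))"
proof -
  note d = der_derI[OF lie0_der[OF assms]]
  have L: "(u,(C,C'),v) \<in> lie J" using assms by (simp add: lie_iff)
  show "exp_p J x (u,(C,C'),v) = (u - C x - scale_p J half (Tp J x v x), (C,C') + inner_der J x v, v)"
    unfolding exp_p_def exp_ad_def restrict_apply'[OF L] zero_prod_def
    by (auto simp: inner_der_def fun_eq_iff prod_eq_iff Tlin d lie_scale_def scale_0_def)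
  show "exp_m J y (u,(C,C'),v) = (u, (C,C') - inner_der J u y, v - C' y - scale_m J half (Tm J y u y))"
    unfolding exp_m_def exp_ad_def restrict_apply'[OF L] zero_prod_def
    by (auto simp: inner_der_def fun_eq_iff prod_eq_iff Tlin d lie_scale_def scale_0_def)
qed

lemma exp_add: "exp_p J (u + v) = exp_p J u \<otimes>\<^bsub>B\<^esub> exp_p J v" "exp_m J (w + y) = exp_m J w \<otimes>\<^bsub>B\<^esub> exp_m J y"
proof -
  note c = exp_car[THEN G_sub]
  have hp: "scale_p J half (P + P) = P" for P using half_p[of P] by (simp add: p.scale_right_distrib)
  have hm: "scale_m J half (P + P) = P" for P using half_m[of P] by (simp add: m.scale_right_distrib)
  have sp: "Tp J (u + v) z (u + v) = Tp J u z u + (Tp J u z v + Tp J u z v) + Tp J v z v" for z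
    by (simp add: Tlin Tp_sym[of v z u])
  have sm: "Tm J (w + y) z (w + y) = Tm J w z w + (Tm J w z y + Tm J w z y) + Tm J y z y" for z
    by (simp add: Tlin Tm_sym[of y z w])
  show "exp_p J (u + v) = exp_p J u \<otimes>\<^bsub>B\<^esub> exp_p J v"
  proof (rule B_eqI)
    fix X assume X: "X \<in> lie J"
    obtain a C C' b where Xe: "X = (a,(C,C'),b)" by (cases X) auto
    have C: "(C,C') \<in> lie0 J" using X Xe by (simp add: lie_iff)
    note d = der_derI[OF lie0_der[OF C]]
    have D: "(C + fst (inner_der J v b), C' + snd (inner_der J v b)) \<in> lie0 J"
      using lie0_ops(1)[OF C inner_lie0[of v b]] by (simp add: plus_prod_def)
    have "exp_p J u (exp_p J v X) = exp_p J (u + v) X"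
      unfolding Xe exp_val[OF C] using exp_val(1)[OF D, of u] 
      unfolding sp p.scale_right_distrib[of half "_ + (_ + _)"] p.scale_right_distrib[of half "Tp J u b u"] hp
      by (simp add: d plus_prod_def inner_der_def fun_eq_iff Tlin algebra_simps Tp_sym[of v b u])
    then show "exp_p J (u + v) X = (exp_p J u \<otimes>\<^bsub>B\<^esub> exp_p J v) X"
      using X c by (simp add: B_app)
  qed (use c in auto)
  show "exp_m J (w + y) = exp_m J w \<otimes>\<^bsub>B\<^esub> exp_m J y"
  proof (rule B_eqI)
    fix X assume X: "X \<in> lie J"
    obtain a C C' b where Xe: "X = (a,(C,C'),b)" by (cases X) auto
    have C: "(C,C') \<in> lie0 J" using X Xe by (simp add: lie_iff)
    note d = der_derI[OF lie0_der[OF C]]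
    have D: "(C - fst (inner_der J a y), C' - snd (inner_der J a y)) \<in> lie0 J"
      using lie0_ops(2)[OF C inner_lie0[of a y]] by (simp add: minus_prod_def)
    have "exp_m J w (exp_m J y X) = exp_m J (w + y) X"
      unfolding Xe exp_val[OF C] using exp_val(2)[OF D, of w] 
      unfolding sm m.scale_right_distrib[of half "_ + (_ + _)"] m.scale_right_distrib[of half "Tm J w a w"] hm
      by (simp add: d minus_prod_def inner_der_def fun_eq_iff Tlin algebra_simps Tm_sym[of y a w])
    then show "exp_m J (w + y) X = (exp_m J w \<otimes>\<^bsub>B\<^esub> exp_m J y) X"
      using X c by (simp add: B_app)
  qed (use c in auto)
qed

lemma exp_zero: "exp_p J 0 = \<one>\<^bsub>B\<^esub>" "exp_m J 0 = \<one>\<^bsub>B\<^esub>"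
  using exp_add(1)[of 0 0] exp_add(2)[of 0 0] exp_car[THEN G_sub] BG.l_cancel_one' by (metis add_0)+


abbreviation "Eu \<equiv> (0, (\<lambda>z. z, \<lambda>z. - z), 0) :: ('p,'m) tkk"

lemma Eu: "Eu \<in> lie J" "Eu \<in> grade_0 J"
  by (auto simp: lie_iff grade_0_def lie0_def intro: z.span_base)

lemma H_sub: "h \<in> H_grp J \<Longrightarrow> h \<in> carrier G" by (simp add: H_grp_def)

lemma grade_lie: "grade_p \<subseteq> lie J" "grade_0 J \<subseteq> lie J" "grade_m \<subseteq> lie J"
  by (auto simp: grade_p_def grade_0_def grade_m_def lie_iff)

lemma H_subgroup: "subgroup (H_grp J) G"
proof (rule GG.subgroupI)
  have im: "\<one>\<^bsub>B\<^esub> ` S = S" if "S \<subseteq> lie J" for S using that B_one by force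
  show "H_grp J \<noteq> {}" using im grade_lie GG.one_closed unfolding H_grp_def by auto
  fix h assume h: "h \<in> H_grp J"
  have iv: "(inv\<^bsub>B\<^esub> h) ` S = S" if "S \<subseteq> lie J" "h ` S = S" for S
  proof -
    have "(inv\<^bsub>B\<^esub> h) ` (h ` S) = S"
      using that(1) B_inv_app(2)[OF G_sub[OF H_sub[OF h]]] by force
    then show ?thesis using that by simp
  qed
  show "inv\<^bsub>G\<^esub> h \<in> H_grp J" using h iv grade_lie
    unfolding G_inv[OF H_sub[OF h]] H_grp_def using GG.inv_closed[OF H_sub[OF h]] G_inv[OF H_sub[OF h]] by auto
  fix k assume k: "k \<in> H_grp J"
  have mv: "(h \<otimes>\<^bsub>B\<^esub> k) ` S = S" if "S \<subseteq> lie J" "h ` S = S" "k ` S = S" for S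
  proof -
    have "(h \<otimes>\<^bsub>B\<^esub> k) ` S = h ` (k ` S)"
      using that(1) B_app[OF G_sub[OF H_sub[OF h]] G_sub[OF H_sub[OF k]]] by force
    then show ?thesis using that by simp
  qed
  show "h \<otimes>\<^bsub>G\<^esub> k \<in> H_grp J" using h k mv grade_lie GG.m_closed[OF H_sub[OF h] H_sub[OF k]]
    unfolding H_grp_def by auto
qed (use H_sub in auto)

definition hp where "hp h u = fst (h (u,0,0::'m))"
definition hm where "hm h w = snd (snd (h (0::'p,0,w)))"

lemma H_val: assumes h: "h \<in> H_grp J"
  shows "h (u,0,0) = (hp h u,0,0)" "h (0,0,w) = (0,0,hm h w)"
proof -
  have "h (u,0,0) \<in> grade_p" "h (0,0,w) \<in> grade_m" using h by (auto simp: H_grp_def grade_p_def grade_m_def)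
  then show "h (u,0,0) = (hp h u,0,0)" "h (0,0,w) = (0,0,hm h w)"
    by (auto simp: hp_def hm_def grade_p_def grade_m_def)
qed

lemma hp_lin: assumes h: "h \<in> H_grp J"
  shows "hp h (u + v) = hp h u + hp h v" "hp h (scale_p J r u) = scale_p J r (hp h u)"
    "hm h (w + y) = hm h w + hm h y" "hm h (scale_m J r w) = scale_m J r (hm h w)"
proof -
  note l = G_lieaut[OF H_sub[OF h], unfolded lieaut_def]
  have L: "(u,0,0) \<in> lie J" "(v,0,0) \<in> lie J" "(0,0,w) \<in> lie J" "(0,0,y) \<in> lie J" for u v w y by (auto simp: lie_iff)
  have z0: "scale_0 J r 0 = 0" by simp
  have "h ((u,0,0) + (v,0,0)) = h (u,0,0) + h (v,0,0)" "h (lie_scale J r (u,0,0)) = lie_scale J r (h (u,0,0))"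
    "h ((0,0,w) + (0,0,y)) = h (0,0,w) + h (0,0,y)" "h (lie_scale J r (0,0,w)) = lie_scale J r (h (0,0,w))"
    using l L by blast+
  then show "hp h (u + v) = hp h u + hp h v" "hp h (scale_p J r u) = scale_p J r (hp h u)"
    "hm h (w + y) = hm h w + hm h y" "hm h (scale_m J r w) = scale_m J r (hm h w)"
    by (simp_all add: H_val[OF h] lie_scale_def)
qed

lemma H_exp: assumes h: "h \<in> H_grp J"
  shows "h \<otimes>\<^bsub>B\<^esub> exp_p J u = exp_p J (hp h u) \<otimes>\<^bsub>B\<^esub> h" "h \<otimes>\<^bsub>B\<^esub> exp_m J w = exp_m J (hm h w) \<otimes>\<^bsub>B\<^esub> h"
  using conj_exp[OF G_lieaut[OF H_sub[OF h]], of "(u,0,0)"] conj_exp[OF G_lieaut[OF H_sub[OF h]], of "(0,0,w)"]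
  by (simp_all add: H_val[OF h] exp_p_def exp_m_def)

lemma exp_H: assumes h: "h \<in> H_grp J"
  shows "\<exists>u'. exp_p J u \<otimes>\<^bsub>B\<^esub> h = h \<otimes>\<^bsub>B\<^esub> exp_p J u'" "\<exists>w'. exp_m J w \<otimes>\<^bsub>B\<^esub> h = h \<otimes>\<^bsub>B\<^esub> exp_m J w'"
proof -
  have s: "(u,0,0) \<in> grade_p" "(0,0,w) \<in> grade_m" by (auto simp: grade_p_def grade_m_def)
  have "grade_p = h ` grade_p" "grade_m = h ` grade_m" using h by (auto simp: H_grp_def)
  then obtain u' w' where "(u,0,0) = h (u',0,0)" "(0,0,w) = h (0,0,w')"
  proof -
    have "(u,0,0) \<in> h ` grade_p" "(0,0,w) \<in> h ` grade_m" using s h by (auto simp: H_grp_def)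
    then show ?thesis using that unfolding grade_p_def grade_m_def by blast
  qed
  then have "u = hp h u'" "w = hm h w'" using H_val[OF h] by auto
  then show "\<exists>u'. exp_p J u \<otimes>\<^bsub>B\<^esub> h = h \<otimes>\<^bsub>B\<^esub> exp_p J u'" "\<exists>w'. exp_m J w \<otimes>\<^bsub>B\<^esub> h = h \<otimes>\<^bsub>B\<^esub> exp_m J w'"
    using H_exp[OF h] by metis+
qed

lemma P_iff: "k \<in> P_p J \<longleftrightarrow> (\<exists>u. \<exists>h\<in>H_grp J. k = exp_p J u \<otimes>\<^bsub>B\<^esub> h)"
  "k \<in> P_m J \<longleftrightarrow> (\<exists>w. \<exists>h\<in>H_grp J. k = exp_m J w \<otimes>\<^bsub>B\<^esub> h)"
  by (auto simp: P_p_def P_m_def U_p_def U_m_def set_mult_def)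

lemma exp_invG: "inv\<^bsub>G\<^esub> (exp_p J u) = exp_p J (- u)" "inv\<^bsub>G\<^esub> (exp_m J w) = exp_m J (- w)"
  using exp_add(1)[of "- u" u] exp_add(2)[of "- w" w] exp_zero exp_car
  by (auto intro!: GG.inv_equality)

lemma P_sub: "P_p J \<subseteq> carrier G" "P_m J \<subseteq> carrier G"
  using exp_car H_sub GG.m_closed by (auto simp: P_iff)

lemma P_subgroup: "subgroup (P_p J) G" "subgroup (P_m J) G"
proof -
  interpret H: subgroup "H_grp J" G by (rule H_subgroup)
  note c = exp_car H_sub
  note B = exp_car[THEN G_sub] H_sub[THEN G_sub]
  show "subgroup (P_p J) G"
  proof (rule GG.subgroupI)
    show "P_p J \<noteq> {}" using H.one_closed P_iff by blast
    fix k l assume "k \<in> P_p J" "l \<in> P_p J"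
    then obtain u h v j where k: "h \<in> H_grp J" "k = exp_p J u \<otimes>\<^bsub>B\<^esub> h" and l: "j \<in> H_grp J" "l = exp_p J v \<otimes>\<^bsub>B\<^esub> j" by (auto simp: P_iff)
    have "k \<otimes>\<^bsub>B\<^esub> l = exp_p J u \<otimes>\<^bsub>B\<^esub> (h \<otimes>\<^bsub>B\<^esub> exp_p J v) \<otimes>\<^bsub>B\<^esub> j"
      using k l B by (simp add: BG.m_assoc)
    also have "\<dots> = exp_p J (u + hp h v) \<otimes>\<^bsub>B\<^esub> (h \<otimes>\<^bsub>B\<^esub> j)"
      unfolding H_exp[OF k(1)] exp_add using k l B by (simp add: BG.m_assoc)
    finally show "k \<otimes>\<^bsub>G\<^esub> l \<in> P_p J" using H.m_closed[OF k(1) l(1)] by (auto simp: P_iff)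
    have "inv\<^bsub>G\<^esub> k = inv\<^bsub>G\<^esub> h \<otimes>\<^bsub>G\<^esub> exp_p J (- u)"
      using k c GG.inv_mult_group[of "exp_p J u" h] by (simp add: exp_invG)
    also have "\<dots> = exp_p J (hp (inv\<^bsub>G\<^esub> h) (- u)) \<otimes>\<^bsub>B\<^esub> inv\<^bsub>G\<^esub> h"
      using H_exp(1)[OF H.m_inv_closed[OF k(1)]] by simp
    finally show "inv\<^bsub>G\<^esub> k \<in> P_p J" using H.m_inv_closed[OF k(1)] by (auto simp: P_iff)
  qed (use P_sub in auto)
  show "subgroup (P_m J) G"
  proof (rule GG.subgroupI)
    show "P_m J \<noteq> {}" using H.one_closed P_iff by blast
    fix k l assume "k \<in> P_m J" "l \<in> P_m J"
    then obtain u h v j where k: "h \<in> H_grp J" "k = exp_m J u \<otimes>\<^bsub>B\<^esub> h" and l: "j \<in> H_grp J" "l = exp_m J v \<otimes>\<^bsub>B\<^esub> j" by (auto simp: P_iff)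
    have "k \<otimes>\<^bsub>B\<^esub> l = exp_m J u \<otimes>\<^bsub>B\<^esub> (h \<otimes>\<^bsub>B\<^esub> exp_m J v) \<otimes>\<^bsub>B\<^esub> j"
      using k l B by (simp add: BG.m_assoc)
    also have "\<dots> = exp_m J (u + hm h v) \<otimes>\<^bsub>B\<^esub> (h \<otimes>\<^bsub>B\<^esub> j)"
      unfolding H_exp[OF k(1)] exp_add using k l B by (simp add: BG.m_assoc)
    finally show "k \<otimes>\<^bsub>G\<^esub> l \<in> P_m J" using H.m_closed[OF k(1) l(1)] by (auto simp: P_iff)
    have "inv\<^bsub>G\<^esub> k = inv\<^bsub>G\<^esub> h \<otimes>\<^bsub>G\<^esub> exp_m J (- u)"
      using k c GG.inv_mult_group[of "exp_m J u" h] by (simp add: exp_invG)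
    also have "\<dots> = exp_m J (hm (inv\<^bsub>G\<^esub> h) (- u)) \<otimes>\<^bsub>B\<^esub> inv\<^bsub>G\<^esub> h"
      using H_exp(2)[OF H.m_inv_closed[OF k(1)]] by simp
    finally show "inv\<^bsub>G\<^esub> k \<in> P_m J" using H.m_inv_closed[OF k(1)] by (auto simp: P_iff)
  qed (use P_sub in auto)
qed

lemma exp_Eu: "exp_p J u Eu = (- u, fst (snd Eu), 0)" "exp_m J w Eu = (0, fst (snd Eu), w)"
  using Eu by (simp_all add: exp_val lie_iff inner_der_def Tlin prod_eq_iff fun_eq_iff)

lemma P_Eu: "k \<in> P_m J \<Longrightarrow> fst (k Eu) = 0" "k \<in> P_p J \<Longrightarrow> snd (snd (k Eu)) = 0"
proof -
  have "h Eu \<in> grade_0 J" if "h \<in> H_grp J" for h using that Eu by (auto simp: H_grp_def)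
  then have h: "\<exists>C C'. (C,C') \<in> lie0 J \<and> h Eu = (0,(C,C'),0)" if "h \<in> H_grp J" for h using that 
    unfolding grade_0_def by fastforce
  show "fst (k Eu) = 0" if k: "k \<in> P_m J"
  proof -
    obtain w h where "h \<in> H_grp J" "k = exp_m J w \<otimes>\<^bsub>B\<^esub> h" using k P_iff by auto
    moreover obtain C C' where "(C,C') \<in> lie0 J" "h Eu = (0,(C,C'),0)" using h calculation by blast
    ultimately show ?thesis using Eu by (simp add: B_app exp_car[THEN G_sub] H_sub[THEN G_sub] exp_val)
  qed
  show "snd (snd (k Eu)) = 0" if k: "k \<in> P_p J"
  proof -
    obtain w h where "h \<in> H_grp J" "k = exp_p J w \<otimes>\<^bsub>B\<^esub> h" using k P_iff by auto
    moreover obtain C C' where "(C,C') \<in> lie0 J" "h Eu = (0,(C,C'),0)" using h calculation by blast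
    ultimately show ?thesis using Eu by (simp add: B_app exp_car[THEN G_sub] H_sub[THEN G_sub] exp_val)
  qed
qed

lemma exp_in_P: "exp_p J u \<in> P_m J \<Longrightarrow> u = 0" "exp_m J w \<in> P_p J \<Longrightarrow> w = 0"
  using P_Eu exp_Eu by force+

lemma P_Int: "P_p J \<inter> P_m J = H_grp J"
proof
  interpret H: subgroup "H_grp J" G by (rule H_subgroup)
  interpret M: subgroup "P_m J" G by (rule P_subgroup)
  have HP: "H_grp J \<subseteq> P_m J" "H_grp J \<subseteq> P_p J"
  proof -
    have "h = exp_m J 0 \<otimes>\<^bsub>B\<^esub> h" "h = exp_p J 0 \<otimes>\<^bsub>B\<^esub> h" if "h \<in> H_grp J" for h
      using that by (simp_all add: exp_zero G_sub H_sub)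
    then show "H_grp J \<subseteq> P_m J" "H_grp J \<subseteq> P_p J" unfolding subset_iff P_iff by blast+
  qed
  then show "H_grp J \<subseteq> P_p J \<inter> P_m J" by auto
  show "P_p J \<inter> P_m J \<subseteq> H_grp J"
  proof
    fix k assume k: "k \<in> P_p J \<inter> P_m J"
    then obtain u h where h: "h \<in> H_grp J" "k = exp_p J u \<otimes>\<^bsub>B\<^esub> h" using P_iff by auto
    have "exp_p J u = k \<otimes>\<^bsub>G\<^esub> inv\<^bsub>G\<^esub> h" using h exp_car H_sub GG.inv_solve_right[of "exp_p J u" k h] GG.m_closed[of "exp_p J u" h] by simp
    moreover have "k \<otimes>\<^bsub>G\<^esub> inv\<^bsub>G\<^esub> h \<in> P_m J" using k h HP by (intro M.m_closed M.m_inv_closed) auto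
    ultimately have "exp_p J u \<in> P_m J" by simp
    then have "u = 0" by (rule exp_in_P)
    then show "k \<in> H_grp J" using h by (simp add: exp_zero H_sub G_sub)
  qed
qed


lemma o_eq: "o_p J = P_m J" "o_m J = P_p J"
  unfolding o_p_def o_m_def by (rule GG.lcos_mult_one, rule P_sub)+

lemma act_act: "g \<in> carrier G \<Longrightarrow> k \<in> carrier G \<Longrightarrow> S \<subseteq> carrier G \<Longrightarrow> act J g (act J k S) = act J (g \<otimes>\<^bsub>B\<^esub> k) S"
  unfolding act_def using GG.lcos_m_assoc[of S g k] by simp

lemma act_one: "S \<subseteq> carrier G \<Longrightarrow> act J \<one>\<^bsub>B\<^esub> S = S"
  unfolding act_def using GG.lcos_mult_one[of S] by simp

lemma act_sub: "g \<in> carrier G \<Longrightarrow> S \<subseteq> carrier G \<Longrightarrow> act J g S \<subseteq> carrier G"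
  unfolding act_def by (rule GG.l_coset_subset_G)

lemma act_inv: assumes "g \<in> carrier G" "S \<subseteq> carrier G" shows "act J (inv\<^bsub>G\<^esub> g) (act J g S) = S" "act J g (act J (inv\<^bsub>G\<^esub> g) S) = S"
  using assms act_act[of "inv\<^bsub>G\<^esub> g" g S] act_act[of g "inv\<^bsub>G\<^esub> g" S] act_one[of S] GG.l_inv[of g] GG.r_inv[of g] by simp_all

lemma act_P: assumes "subgroup S G" "k \<in> S" shows "act J k S = S"
  unfolding act_def
proof -
  interpret S: subgroup S G by fact
  show "k <#\<^bsub>G\<^esub> S = S"
  proof
    show "k <#\<^bsub>G\<^esub> S \<subseteq> S" using assms S.m_closed unfolding l_coset_def by auto
    show "S \<subseteq> k <#\<^bsub>G\<^esub> S"
    proof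
      fix x assume x: "x \<in> S"
      have "x = k \<otimes>\<^bsub>G\<^esub> (inv\<^bsub>G\<^esub> k \<otimes>\<^bsub>G\<^esub> x)" using x assms S.mem_carrier
          GG.m_assoc[of k "inv\<^bsub>G\<^esub> k" x] GG.r_inv[of k] GG.l_one[of x] GG.inv_closed[of k] by simp
      then show "x \<in> k <#\<^bsub>G\<^esub> S" unfolding l_coset_def using x assms S.m_closed S.m_inv_closed by blast
    qed
  qed
qed

lemma act_eq: assumes "subgroup S G" "g \<in> carrier G" "k \<in> carrier G" "act J g S = act J k S"
  shows "inv\<^bsub>G\<^esub> g \<otimes>\<^bsub>G\<^esub> k \<in> S"
proof -
  interpret S: subgroup S G by fact
  have "k \<otimes>\<^bsub>G\<^esub> \<one>\<^bsub>G\<^esub> \<in> act J k S" unfolding act_def l_coset_def using S.one_closed by blast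
  then have "k \<in> act J g S" using assms GG.r_one[of k] by simp
  then obtain s where "s \<in> S" "k = g \<otimes>\<^bsub>G\<^esub> s" unfolding act_def l_coset_def by blast
  then show ?thesis using assms S.mem_carrier by (metis GG.inv_solve_left')
qed

lemma chart_p_eq: "g \<in> carrier G \<Longrightarrow> chart_p J g u = act J (g \<otimes>\<^bsub>B\<^esub> exp_p J u) (P_m J)"
  unfolding chart_p_def o_eq by (rule act_act) (simp_all add: exp_car P_sub)

lemma Gm: "g \<in> carrier G \<Longrightarrow> k \<in> carrier G \<Longrightarrow> g \<otimes>\<^bsub>B\<^esub> k \<in> carrier G" using GG.m_closed[of g k] by simp

lemma Ga: "g \<in> carrier G \<Longrightarrow> k \<in> carrier G \<Longrightarrow> l \<in> carrier G \<Longrightarrow> (g \<otimes>\<^bsub>B\<^esub> k) \<otimes>\<^bsub>B\<^esub> l = g \<otimes>\<^bsub>B\<^esub> (k \<otimes>\<^bsub>B\<^esub> l)"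
  using GG.m_assoc[of g k l] by simp

lemma chart_p_inj: assumes g: "g \<in> carrier G" and e: "chart_p J g u = chart_p J g v" shows "u = v"
proof -
  have "act J (exp_p J u) (P_m J) = act J (exp_p J v) (P_m J)"
    using e act_inv(1)[OF g act_sub[OF exp_car(1) P_sub(2)]] unfolding chart_p_def o_eq by metis
  from act_eq[OF P_subgroup(2) exp_car(1) exp_car(1) this]
  have "exp_p J (- u + v) \<in> P_m J" unfolding exp_add by (simp add: exp_invG)
  then show ?thesis using exp_in_P(1) by fastforce
qed

lemma chart_p_change:
  assumes g: "g \<in> carrier G" and h: "h \<in> H_grp J"
  shows "chart_p J (g \<otimes>\<^bsub>B\<^esub> (exp_p J w \<otimes>\<^bsub>B\<^esub> h)) u = chart_p J g (w + hp h u)"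
proof -
  have P: "h \<in> P_m J" using h P_Int by auto
  note c = g H_sub[OF h] exp_car Gm
  have "chart_p J (g \<otimes>\<^bsub>B\<^esub> (exp_p J w \<otimes>\<^bsub>B\<^esub> h)) u = act J (g \<otimes>\<^bsub>B\<^esub> (exp_p J w \<otimes>\<^bsub>B\<^esub> (h \<otimes>\<^bsub>B\<^esub> exp_p J u))) (P_m J)"
    using c by (simp add: chart_p_eq Ga)
  also have "\<dots> = act J ((g \<otimes>\<^bsub>B\<^esub> exp_p J (w + hp h u)) \<otimes>\<^bsub>B\<^esub> h) (P_m J)"
    unfolding H_exp[OF h] exp_add using c by (simp add: Ga)
  also have "\<dots> = act J (g \<otimes>\<^bsub>B\<^esub> exp_p J (w + hp h u)) (act J h (P_m J))"
    using c by (simp add: act_act P_sub)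
  also have "\<dots> = chart_p J g (w + hp h u)"
    by (simp add: act_P[OF P_subgroup(2) P] chart_p_eq[OF g])
  finally show ?thesis .
qed

lemma P_p_change:
  assumes g: "g \<in> carrier G" "g' \<in> carrier G" and e: "act J g (o_m J) = act J g' (o_m J)"
  obtains w h where "h \<in> H_grp J" "g' = g \<otimes>\<^bsub>B\<^esub> (exp_p J w \<otimes>\<^bsub>B\<^esub> h)"
proof -
  have "inv\<^bsub>G\<^esub> g \<otimes>\<^bsub>G\<^esub> g' \<in> P_p J" using act_eq[OF P_subgroup(1) g] e o_eq by simp
  then obtain w h where h: "h \<in> H_grp J" "inv\<^bsub>G\<^esub> g \<otimes>\<^bsub>G\<^esub> g' = exp_p J w \<otimes>\<^bsub>G\<^esub> h" using P_iff by auto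
  moreover have "g' = g \<otimes>\<^bsub>G\<^esub> (inv\<^bsub>G\<^esub> g \<otimes>\<^bsub>G\<^esub> g')" using g by (metis GG.inv_closed GG.m_assoc GG.r_inv GG.l_one)
  ultimately show ?thesis using that by simp
qed

lemma Pi_p_chart:
  assumes g: "g \<in> carrier G"
  shows "Pi_p J r (chart_p J g u) (act J g (o_m J)) (chart_p J g v) = chart_p J g (scale_p J (1 - r) u + scale_p J r v)"
  unfolding Pi_p_def
proof (rule the_equality)
  show "\<exists>ga\<in>carrier G. \<exists>ua va. act J g (o_m J) = act J ga (o_m J) \<and> chart_p J g u = chart_p J ga ua \<and> chart_p J g v = chart_p J ga va \<and>
       chart_p J g (scale_p J (1 - r) u + scale_p J r v) = chart_p J ga (scale_p J (1 - r) ua + scale_p J r va)"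
    using g by blast
next
  fix z assume "\<exists>ga\<in>carrier G. \<exists>ua va. act J g (o_m J) = act J ga (o_m J) \<and> chart_p J g u = chart_p J ga ua \<and> chart_p J g v = chart_p J ga va \<and>
       z = chart_p J ga (scale_p J (1 - r) ua + scale_p J r va)"
  then obtain g' u' v' where g': "g' \<in> carrier G" "act J g (o_m J) = act J g' (o_m J)" "chart_p J g u = chart_p J g' u'" 
     "chart_p J g v = chart_p J g' v'" and z: "z = chart_p J g' (scale_p J (1 - r) u' + scale_p J r v')" by blast
  obtain w h where h: "h \<in> H_grp J" "g' = g \<otimes>\<^bsub>B\<^esub> (exp_p J w \<otimes>\<^bsub>B\<^esub> h)" using P_p_change[OF g g'(1,2)] .
  note ch = chart_p_change[OF g h(1), of w, folded h(2)]
  have "u = w + hp h u'" "v = w + hp h v'" using g'(3,4) chart_p_inj[OF g] ch by simp_all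
  moreover have "scale_p J (1 - r) w + scale_p J r w = w"
    by (simp flip: p.scale_left_distrib)
  then have "scale_p J (1 - r) (w + P) + scale_p J r (w + Q) = w + (scale_p J (1 - r) P + scale_p J r Q)" for P Q
  proof -
    have "scale_p J (1 - r) (w + P) + scale_p J r (w + Q) = (scale_p J (1 - r) w + scale_p J r w) + (scale_p J (1 - r) P + scale_p J r Q)"
      by (simp only: p.scale_right_distrib add_ac)
    then show ?thesis by (simp only: \<open>scale_p J (1 - r) w + scale_p J r w = w\<close>)
  qed
  ultimately have "w + hp h (scale_p J (1 - r) u' + scale_p J r v') = scale_p J (1 - r) u + scale_p J r v"
    by (simp only: hp_lin[OF h(1)])
  then show "z = chart_p J g (scale_p J (1 - r) u + scale_p J r v)" using z ch by simp
qed

lemma dil_app: "(x,A,y) \<in> lie J \<Longrightarrow> grade_dil J r (x,A,y) = (scale_p J r x, A, scale_m J (ring_inv r) y)"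
  by (simp add: grade_dil_def)

lemma dil_lieaut: assumes r: "r dvd 1" shows "lieaut (grade_dil J r)"
proof -
  let ?s = "ring_inv r"
  have rs: "r * ?s = 1" "?s * r = 1" using ring_inv[OF r] by (simp_all add: mult.commute)
  have into: "grade_dil J r X \<in> lie J" if "X \<in> lie J" for X
    using that by (cases X) (simp add: dil_app lie_iff)
  have "bij_betw (grade_dil J r) (lie J) (lie J)"
    by (rule bij_betw_byWitness[where f' = "\<lambda>(x,A,y). (scale_p J ?s x, A, scale_m J r y)"])
      (auto simp: dil_app lie_iff rs p.scale_scale m.scale_scale)
  then have b: "grade_dil J r \<in> Bij (lie J)" by (auto simp: Bij_def grade_dil_def split_def)
  show ?thesis unfolding lieaut_def
  proof (intro conjI ballI allI b)
    fix X Y assume X: "X \<in> lie J" and Y: "Y \<in> lie J"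
    obtain x A A' y where Xe: "X = (x,(A,A'),y)" by (cases X) auto
    obtain u C C' v where Ye: "Y = (u,(C,C'),v)" by (cases Y) auto
    have dC: "der (A,A')" "der (C,C')" using X Y Xe Ye lie0_der by (auto simp: lie_def)
    note d = der_derI[OF dC(1)] der_derI[OF dC(2)]
    show "grade_dil J r (X + Y) = grade_dil J r X + grade_dil J r Y"
      using X Y lie_ops(1)[OF X Y] unfolding Xe Ye by (simp add: dil_app p.scale_right_distrib m.scale_right_distrib)
    show "grade_dil J r (lie_bracket J X Y) = lie_bracket J (grade_dil J r X) (grade_dil J r Y)"
      using X Y lie_bracket_closed[OF X Y] unfolding Xe Ye
      by (simp add: dil_app inner_der_def prod_eq_iff fun_eq_iff d Tlin p.scale_right_diff_distrib m.scale_right_diff_distrib rs)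
  next
    fix t X assume X: "X \<in> lie J"
    obtain x A A' y where Xe: "X = (x,(A,A'),y)" by (cases X) auto
    show "grade_dil J r (lie_scale J t X) = lie_scale J t (grade_dil J r X)"
      using X lie_ops(4)[OF X, of t] unfolding Xe by (simp add: dil_app lie_scale_def mult.commute)
  qed
qed

definition cj where "cj r k = grade_dil J r \<otimes>\<^bsub>B\<^esub> k \<otimes>\<^bsub>B\<^esub> inv\<^bsub>B\<^esub> (grade_dil J r)"

lemma dil_car: "r dvd 1 \<Longrightarrow> grade_dil J r \<in> carrier B" using dil_lieaut by (simp add: lieaut_def carB)

lemma cj_mult: assumes r: "r dvd 1" and "k \<in> carrier B" "l \<in> carrier B" shows "cj r (k \<otimes>\<^bsub>B\<^esub> l) = cj r k \<otimes>\<^bsub>B\<^esub> cj r l"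
proof -
  let ?d = "grade_dil J r"
  have "cj r k \<otimes>\<^bsub>B\<^esub> cj r l = ?d \<otimes>\<^bsub>B\<^esub> k \<otimes>\<^bsub>B\<^esub> (inv\<^bsub>B\<^esub> ?d \<otimes>\<^bsub>B\<^esub> ?d) \<otimes>\<^bsub>B\<^esub> l \<otimes>\<^bsub>B\<^esub> inv\<^bsub>B\<^esub> ?d"
    unfolding cj_def using assms dil_car[OF r] by (simp only: BG.m_assoc BG.m_closed BG.inv_closed)
  then show ?thesis unfolding cj_def using assms dil_car[OF r] by (simp add: BG.m_assoc)
qed

lemma cj_exp: assumes r: "r dvd 1" shows "cj r (exp_p J u) = exp_p J (scale_p J r u)" "cj r (exp_m J w) = exp_m J (scale_m J (ring_inv r) w)"
proof -
  have L: "(u,0,0) \<in> lie J" "(0,0,w) \<in> lie J" by (auto simp: lie_iff)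
  have e: "grade_dil J r (u,0,0) = (scale_p J r u,0,0)" "grade_dil J r (0,0,w) = (0,0,scale_m J (ring_inv r) w)"
    using dil_app[OF L(1)] dil_app[OF L(2)] by simp_all
  show "cj r (exp_p J u) = exp_p J (scale_p J r u)" "cj r (exp_m J w) = exp_m J (scale_m J (ring_inv r) w)"
    using conj_exp[OF dil_lieaut[OF r], of "(u,0,0)"] conj_exp[OF dil_lieaut[OF r], of "(0,0,w)"] e
      exp_car[THEN G_sub] dil_car[OF r]
    unfolding cj_def exp_p_def exp_m_def by (simp_all add: BG.m_assoc exp_p_def exp_m_def)
qed

lemma cj_H: assumes r: "r dvd 1" and h: "h \<in> H_grp J" shows "cj r h = h"
proof -
  note l = G_lieaut[OF H_sub[OF h], unfolded lieaut_def]
  have dh: "grade_dil J r \<otimes>\<^bsub>B\<^esub> h = h \<otimes>\<^bsub>B\<^esub> grade_dil J r"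
  proof (rule B_eqI)
    fix X assume X: "X \<in> lie J"
    obtain x A y where Xe: "X = (x,A,y)" by (cases X) auto
    have A: "(0,A,0) \<in> grade_0 J" using X Xe unfolding lie_iff grade_0_def by (cases A) auto
    then have "h (0,A,0) \<in> grade_0 J" using h by (auto simp: H_grp_def)
    then obtain C where C: "h (0,A,0) = (0,C,0)" "C \<in> lie0 J" by (auto simp: grade_0_def)
    have hv: "h (a,A,b) = (hp h a, C, hm h b)" for a b
    proof -
      have L: "(a,0,0) \<in> lie J" "(0,A,0) \<in> lie J" "(0,0,b) \<in> lie J" "(a,A,0) \<in> lie J" using X Xe by (auto simp: lie_iff)
      have "h ((a,A,0) + (0,0,b)) = h (a,A,0) + h (0,0,b)" "h ((a,0,0) + (0,A,0)) = h (a,0,0) + h (0,A,0)" using l L by blast+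
      then show ?thesis using C H_val[OF h] by simp
    qed
    have L: "(hp h x, C, hm h y) \<in> lie J" using C by (simp add: lie_iff)
    show "(grade_dil J r \<otimes>\<^bsub>B\<^esub> h) X = (h \<otimes>\<^bsub>B\<^esub> grade_dil J r) X"
      using X L unfolding Xe by (simp add: B_app dil_car[OF r] G_sub[OF H_sub[OF h]] hv dil_app hp_lin[OF h])
  qed (use dil_car[OF r] G_sub[OF H_sub[OF h]] in auto)
  show ?thesis unfolding cj_def dh using dil_car[OF r] G_sub[OF H_sub[OF h]] by (simp add: BG.m_assoc)
qed

lemma coset_dil_cj: "coset_dil J r C = cj r ` C" unfolding coset_dil_def cj_def ..

lemma cj_P: assumes r: "r dvd 1" shows "cj r ` P_m J = P_m J"
proof
  show "cj r ` P_m J \<subseteq> P_m J"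
    using exp_car[THEN G_sub] H_sub[THEN G_sub] by (force simp: P_iff cj_mult[OF r] cj_exp[OF r] cj_H[OF r])
  show "P_m J \<subseteq> cj r ` P_m J"
  proof
    fix k assume "k \<in> P_m J"
    then obtain w h where h: "h \<in> H_grp J" "k = exp_m J w \<otimes>\<^bsub>B\<^esub> h" using P_iff by auto
    have "ring_inv r * r = 1" using ring_inv[OF r] by (simp add: mult.commute)
    then have "k = cj r (exp_m J (scale_m J r w) \<otimes>\<^bsub>B\<^esub> h)"
      using h exp_car[THEN G_sub] H_sub[THEN G_sub] by (simp add: cj_mult[OF r] cj_exp[OF r] cj_H[OF r])
    then show "k \<in> cj r ` P_m J" using h P_iff by blast
  qed
qed

lemma cj_G: assumes r: "r dvd 1" and k: "k \<in> carrier G" shows "cj r k \<in> carrier G"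
proof -
  have cjB: "cj r l \<in> carrier B" if "l \<in> carrier B" for l using that dil_car[OF r] by (simp add: cj_def)
  show ?thesis using k unfolding G_carrier
  proof (induction rule: generate.induct)
    case one
    have "cj r \<one>\<^bsub>B\<^esub> = \<one>\<^bsub>B\<^esub>" unfolding cj_def using dil_car[OF r] by simp
    then show ?case by (simp add: generate.one)
  next
    case (incl h) then show ?case using cj_exp[OF r] exp_car by (auto simp: U_p_def U_m_def G_carrier)
  next
    case (inv h) 
    then have "inv\<^bsub>B\<^esub> h \<in> U_p J \<union> U_m J" using exp_invG G_inv exp_car by (auto simp: U_p_def U_m_def)
    then show ?case using cj_exp[OF r] exp_car by (auto simp: U_p_def U_m_def G_carrier)
  next
    case (eng h1 h2) then show ?case using G_sub by (simp add: cj_mult[OF r] G_carrier generate.eng)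
  qed
qed

lemma dil_act: assumes r: "r dvd 1" and k: "k \<in> carrier G" and S: "S \<subseteq> carrier G"
  shows "coset_dil J r (act J k S) = act J (cj r k) (coset_dil J r S)"
proof -
  have "cj r (k \<otimes>\<^bsub>B\<^esub> s) = cj r k \<otimes>\<^bsub>B\<^esub> cj r s" if "s \<in> S" for s
    using cj_mult[OF r] k S that G_sub by blast
  then show ?thesis unfolding coset_dil_cj act_def l_coset_def by (simp add: image_UN)
qed

lemma X_form: "y \<in> X_p J \<longleftrightarrow> (\<exists>k\<in>carrier G. y = act J k (P_m J))"
  by (auto simp: X_p_def LCOSETS_def act_def)

lemma Pi_p_ext_eq:
  assumes r: "r dvd 1" and g: "g \<in> carrier G" and y: "y \<in> X_p J"
  shows "Pi_p_ext J r (act J g (o_p J)) (act J g (o_m J)) y = act J g (coset_dil J r (act J (inv\<^bsub>G\<^esub> g) y))"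
  unfolding Pi_p_ext_def
proof (rule the_equality)
  show "\<exists>ga\<in>carrier G. act J g (o_p J) = act J ga (o_p J) \<and> act J g (o_m J) = act J ga (o_m J) \<and>
     act J g (coset_dil J r (act J (inv\<^bsub>G\<^esub> g) y)) = act J ga (coset_dil J r (act J (inv\<^bsub>G\<^esub> ga) y))" using g by blast
next
  fix z assume "\<exists>ga\<in>carrier G. act J g (o_p J) = act J ga (o_p J) \<and> act J g (o_m J) = act J ga (o_m J) \<and>
     z = act J ga (coset_dil J r (act J (inv\<^bsub>G\<^esub> ga) y))"
  then obtain g' where g': "g' \<in> carrier G" "act J g (o_p J) = act J g' (o_p J)" "act J g (o_m J) = act J g' (o_m J)"
    and z: "z = act J g' (coset_dil J r (act J (inv\<^bsub>G\<^esub> g') y))" by blast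
  define h where "h = inv\<^bsub>G\<^esub> g \<otimes>\<^bsub>G\<^esub> g'"
  have h: "h \<in> H_grp J" unfolding P_Int[symmetric] h_def
    using act_eq[OF P_subgroup(1) g g'(1)] act_eq[OF P_subgroup(2) g g'(1)] g' o_eq by simp
  have gg: "g' = g \<otimes>\<^bsub>G\<^esub> h" unfolding h_def using g g' by (metis GG.inv_closed GG.m_assoc GG.r_inv GG.l_one)
  have hc: "h \<in> carrier G" "inv\<^bsub>G\<^esub> h \<in> carrier G" using H_sub[OF h] by auto
  interpret H: subgroup "H_grp J" G by (rule H_subgroup)
  obtain k where k: "k \<in> carrier G" "y = act J k (P_m J)" using y X_form by auto
  have yG: "y \<subseteq> carrier G" unfolding k using k P_sub by (simp add: act_sub)
  have Y: "act J (inv\<^bsub>G\<^esub> g) y \<subseteq> carrier G" using g yG by (simp add: act_sub)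
  have cG: "coset_dil J r (act J (inv\<^bsub>G\<^esub> g) y) \<subseteq> carrier G" unfolding coset_dil_cj using cj_G[OF r] Y by auto
  have "act J (inv\<^bsub>G\<^esub> g') y = act J (inv\<^bsub>G\<^esub> h) (act J (inv\<^bsub>G\<^esub> g) y)"
    using gg g hc yG GG.inv_mult_group[of g h] by (simp add: act_act)
  then have "coset_dil J r (act J (inv\<^bsub>G\<^esub> g') y) = act J (inv\<^bsub>G\<^esub> h) (coset_dil J r (act J (inv\<^bsub>G\<^esub> g) y))"
    using dil_act[OF r hc(2) Y] cj_H[OF r H.m_inv_closed[OF h]] by simp
  then have "z = act J g (act J h (act J (inv\<^bsub>G\<^esub> h) (coset_dil J r (act J (inv\<^bsub>G\<^esub> g) y))))"
    unfolding z gg using g hc cG act_act[of g h "act J (inv\<^bsub>G\<^esub> h) (coset_dil J r (act J (inv\<^bsub>G\<^esub> g) y))"] act_sub by simp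
  then show "z = act J g (coset_dil J r (act J (inv\<^bsub>G\<^esub> g) y))" using act_inv(2)[OF hc(1) cG] by simp
qed

theorem Pi_p_ext_extends:
  assumes r: "r dvd 1" and x: "x \<in> v_of_m J a" and y: "y \<in> v_of_m J a"
  shows "Pi_p_ext J r x a y = Pi_p J r x a y"
proof -
  obtain g where g: "g \<in> carrier G" "x = act J g (o_p J)" "a = act J g (o_m J)"
    using x by (auto simp: v_of_m_def transversal_def)
  obtain g' where g': "g' \<in> carrier G" "y = act J g' (o_p J)" "a = act J g' (o_m J)"
    using y by (auto simp: v_of_m_def transversal_def)
  have o0: "act J k (o_p J) = chart_p J k 0" if "k \<in> carrier G" for k
    using that by (simp add: chart_p_def exp_zero act_one o_eq P_sub)
  obtain w h where h: "h \<in> H_grp J" "g' = g \<otimes>\<^bsub>B\<^esub> (exp_p J w \<otimes>\<^bsub>B\<^esub> h)"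
    using P_p_change[OF g(1) g'(1)] g(3) g'(3) by metis
  obtain v where v: "y = chart_p J g v"
    using chart_p_change[OF g(1) h(1), of w 0] h(2) o0[OF g'(1)] g'(2) by auto
  have yX: "y \<in> X_p J" using y by (simp add: v_of_m_def)
  have "Pi_p_ext J r x a y = act J g (coset_dil J r (act J (exp_p J v) (P_m J)))"
    using Pi_p_ext_eq[OF r g(1) yX] act_inv(1)[OF g(1) act_sub[OF exp_car(1) P_sub(2)]] v 
    by (simp add: g(2,3) chart_p_def o_eq)
  also have "\<dots> = chart_p J g (scale_p J r v)"
    unfolding dil_act[OF r exp_car(1) P_sub(2)] by (simp add: coset_dil_cj cj_P[OF r] cj_exp[OF r] chart_p_def o_eq)
  also have "\<dots> = Pi_p J r x a y"
    using Pi_p_chart[OF g(1), of r 0 v] by (simp add: g(2,3) o0[OF g(1)] v)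
  finally show ?thesis .
qed

end

end

theory Submission
  imports Defs
begin

text \<open>
  Put \<open>y = -\<alpha>\<close> and \<open>f = exp(-x) exp(y)\<close> with \<open>x \<in> V\<^sup>+\<close>, \<open>y \<in> V\<^sup>-\<close>. The component \<open>\<gg>\<^sub>1 \<rightarrow> \<gg>\<^sub>1\<close> of \<open>f\<close> is
  \<open>B(x,y)\<close>, and \<open>exp(x).o\<^sup>+\<close> is transversal to \<open>exp(y).o\<^sup>-\<close> iff \<open>f \<in> U\<^sup>- H U\<^sup>+\<close>, so transversality makes
  \<open>B(x,y)\<close> invertible. Conversely, if \<open>B(x,y)\<close> is invertible, let \<open>z = \<tau>\<^sup>~\<^sub>y(x)\<close> and \<open>w = y + Q(y)z\<close>; then
  \<open>f exp(z)\<close> maps the grading element \<open>E\<close> to \<open>exp(w)E\<close>, hence \<open>f exp(z) = exp(w) h\<close> with \<open>h \<in> H\<close>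
  acting on \<open>V\<^sup>+\<close> by \<open>B(x,y)\<close>.

  In the chart, the midpoint of \<open>a\<close> and \<open>b\<close> seen from \<open>x\<close> is \<open>exp(x) exp(w/2).o\<^sup>-\<close>, so
  \<open>\<mu>(x,v) = exp(x) exp(w) exp(x) exp(-v).o\<^sup>+\<close>. Conjugating \<open>f exp(z) = exp(w) h\<close> by the dilation \<open>-1\<close>
  gives \<open>exp(w) exp(x) = h exp(z) exp(y) = exp(x - Q(x)y) h exp(y)\<close>, which yields the formula for \<open>\<mu>\<close>.
\<close>

context jordan_pair begin

section \<open>Exponentials and the Bergman operator\<close>

lemma exp_val_grade_pm: "exp_p J x (u,0,v) = (u - Qp J x v, inner_der J x v, v)"
  "exp_m J y (u,0,v) = (u, - inner_der J u y, v - Qm J y u)"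
  using exp_val[where C = 0 and C' = 0] unfolding zero_prod_def[symmetric] by (simp_all add: Qp_def Qm_def)

lemma exp_cancel:
  "exp_p J u \<otimes>\<^bsub>B\<^esub> exp_p J (- u) = \<one>\<^bsub>B\<^esub>" "exp_p J (- u) \<otimes>\<^bsub>B\<^esub> exp_p J u = \<one>\<^bsub>B\<^esub>"
  "exp_m J v \<otimes>\<^bsub>B\<^esub> exp_m J (- v) = \<one>\<^bsub>B\<^esub>" "exp_m J (- v) \<otimes>\<^bsub>B\<^esub> exp_m J v = \<one>\<^bsub>B\<^esub>"
  by (simp_all flip: exp_add add: exp_zero)

lemma two_cancel: "x + x = y + y \<Longrightarrow> x = (y::'p)" "u + u = v + v \<Longrightarrow> u = (v::'m)"
  using half_p[of x] half_p[of y] half_m[of u] half_m[of v]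
  by (metis p.scale_right_distrib, metis m.scale_right_distrib)

lemma Q_double: "Qp J x y + Qp J x y = Tp J x y x" "Qm J y x + Qm J y x = Tm J y x y"
  unfolding Qp_def Qm_def by (rule half_p, rule half_m)

lemma Bergman_linear: "module_hom (scale_p J) (scale_p J) (Bergman J x y)"
  by unfold_locales
    (simp_all add: Bergman_def Qp_def Qm_def Tlin p.scale_right_distrib p.scale_right_diff_distrib
      m.scale_right_distrib mult.commute mult.left_commute)

lemmas Bergman_lin = Bergman_linear[THEN module_hom.add] Bergman_linear[THEN module_hom.diff]
  Bergman_linear[THEN module_hom.neg] Bergman_linear[THEN module_hom.zero]

lemma U_chart_iff: "x \<in> U_chart J a \<longleftrightarrow> bij (Bergman J x (- a))"
  by (simp add: U_chart_def GL_p_def Bergman_linear)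

lemma exp_p_exp_m_val:
  "exp_p J (- x) (exp_m J y (u,0,0)) =
     (Bergman J x y u, inner_der J x (Qm J y u) - inner_der J u y, - Qm J y u)"
proof -
  have D: "- inner_der J u y \<in> lie0 J" by (simp add: lie0_ops inner_lie0)
  have "exp_p J (- x) (u, - inner_der J u y, - Qm J y u) =
     (Bergman J x y u, inner_der J x (Qm J y u) - inner_der J u y, - Qm J y u)"
    using exp_val(1)[of "fst (- inner_der J u y)" "snd (- inner_der J u y)" "- x" u "- Qm J y u"] D
    by (simp add: Bergman_def Qp_def inner_der_def Tlin prod_eq_iff fun_eq_iff Tp_sym[of u y x])
  then show ?thesis by (simp add: exp_val_grade_pm)
qed

text \<open>The first component is the numerator of the quasi-inverse: what a further factor
  \<open>exp_p J z\<close> has to cancel.\<close>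

lemma exp_p_exp_m_Eu:
  "exp_p J (- x) (exp_m J y Eu) = (x - Qp J x y, fst (snd Eu) - inner_der J x y, y)"
  using Eu by (simp add: exp_Eu exp_val lie_iff Qp_def inner_der_def Tlin prod_eq_iff fun_eq_iff)

text \<open>The right-hand side is the dual Bergman operator B(y,x) on V^-. It tests whether an
  element of V^- is the image of an element of grade 0.\<close>

lemma exp_m_exp_p_val:
  "snd (snd (exp_m J (- y) (exp_p J x (0,0,v)))) = v - Tm J y x v + Qm J y (Qp J x v)"
  using exp_val(2)[of "fst (inner_der J x v)" "snd (inner_der J x v)" "- y" "- Qp J x v" v] inner_lie0[of x v]
  by (simp add: exp_val_grade_pm inner_der_def Qm_def Tlin Tm_sym[of v x y])

section \<open>The grading as eigenspaces of the grading element\<close>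

lemma Eu_bracket: assumes "(x, A, y) \<in> lie J" shows "lie_bracket J Eu (x, A, y) = (x, 0, - y)"
proof -
  obtain C C' where A: "A = (C, C')" by fastforce
  then have "(C, C') \<in> lie0 J" using assms by (simp add: lie_iff)
  note d = der_derI[OF lie0_der[OF this]]
  show ?thesis unfolding A by (simp add: d inner_der_def Tlin prod_eq_iff fun_eq_iff)
qed

text \<open>The eigenvalues 1, 0, -1 of ad E can be told apart because 2 is invertible. The grading
  can thus be recovered from E and the bracket.\<close>

lemma grade_eigenspace:
  assumes X: "X \<in> lie J"
  shows "X \<in> grade_p \<longleftrightarrow> lie_bracket J Eu X = X"
    "X \<in> grade_0 J \<longleftrightarrow> lie_bracket J Eu X = 0"
    "X \<in> grade_m \<longleftrightarrow> lie_bracket J Eu X = - X"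
proof -
  obtain x A A' y where Xe: "X = (x, (A, A'), y)" by (cases X) auto
  have A: "(A, A') \<in> lie0 J" using X Xe by (simp add: lie_iff)
  have e: "lie_bracket J Eu X = (x, 0, - y)" using X unfolding Xe by (rule Eu_bracket)
  have zero: "(0::('p, 'm) tkk) = (0, 0, 0)" by (simp add: zero_prod_def)
  have t: "x = - x \<longleftrightarrow> x = 0" "- y = y \<longleftrightarrow> y = 0"
    using two_cancel(1)[of x 0] two_cancel(2)[of y 0] by (auto simp: eq_neg_iff_add_eq_0 neg_eq_iff_add_eq_0)
  show "X \<in> grade_p \<longleftrightarrow> lie_bracket J Eu X = X"
    "X \<in> grade_0 J \<longleftrightarrow> lie_bracket J Eu X = 0"
    "X \<in> grade_m \<longleftrightarrow> lie_bracket J Eu X = - X"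
    using A unfolding e zero
    by (auto simp: Xe grade_p_def grade_0_def grade_m_def t prod_eq_iff)
qed

lemma lieaut_zero_neg: assumes "lieaut f" shows "f 0 = 0" "X \<in> lie J \<Longrightarrow> f (- X) = - f X"
proof -
  have 0: "0 \<in> lie J" by (simp add: lie_iff)
  have s: "f (lie_scale J r X) = lie_scale J r (f X)" if "X \<in> lie J" for r X
    using assms that by (simp add: lieaut_def)
  show "f 0 = 0" using s[OF 0, of 0] by simp
  show "X \<in> lie J \<Longrightarrow> f (- X) = - f X" using s[of X "-1"] by simp
qed

text \<open>An automorphism fixing E commutes with ad E and so maps each eigenspace into itself. The
  same for its inverse turns the inclusions into equalities.\<close>

lemma stabilizer_Eu_H:
  assumes f: "f \<in> carrier G" and fE: "f Eu = Eu"
  shows "f \<in> H_grp J"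
proof -
  have stable: "k ` grade_p \<subseteq> grade_p \<and> k ` grade_0 J \<subseteq> grade_0 J \<and> k ` grade_m \<subseteq> grade_m"
    if k: "k \<in> carrier G" "k Eu = Eu" for k
  proof -
    note l = G_lieaut[OF k(1)]
    have b: "lie_bracket J Eu (k X) = k (lie_bracket J Eu X)" if "X \<in> lie J" for X
      using l that Eu(1) k(2) by (simp add: lieaut_def)
    have "k X \<in> grade_p" if "X \<in> grade_p" for X
      using that grade_lie grade_eigenspace[of X] grade_eigenspace[of "k X"] b[of X] B_in[OF G_sub[OF k(1)], of X] by auto
    moreover have "k X \<in> grade_0 J" if "X \<in> grade_0 J" for X
      using that grade_lie grade_eigenspace[of X] grade_eigenspace[of "k X"] b[of X] B_in[OF G_sub[OF k(1)], of X]
        lieaut_zero_neg[OF l] by auto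
    moreover have "k X \<in> grade_m" if "X \<in> grade_m" for X
      using that grade_lie grade_eigenspace[of X] grade_eigenspace[of "k X"] b[of X] B_in[OF G_sub[OF k(1)], of X]
        lieaut_zero_neg[OF l] by auto
    ultimately show ?thesis by blast
  qed
  have i: "inv\<^bsub>B\<^esub> f \<in> carrier G" "(inv\<^bsub>B\<^esub> f) Eu = Eu"
    using GG.inv_closed[OF f] G_inv[OF f] B_inv_app(2)[OF G_sub[OF f] Eu(1)] fE by simp_all
  have sup: "S \<subseteq> f ` S" if "S \<subseteq> lie J" "(inv\<^bsub>B\<^esub> f) ` S \<subseteq> S" for S
  proof
    fix X assume X: "X \<in> S"
    then have "X = f ((inv\<^bsub>B\<^esub> f) X)" using that(1) B_inv_app(1)[OF G_sub[OF f], of X] by auto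
    then show "X \<in> f ` S" using X that(2) by blast
  qed
  note s = stable[OF f fE] stable[OF i]
  have "f ` grade_p = grade_p" "f ` grade_0 J = grade_0 J" "f ` grade_m = grade_m"
    using s sup[OF grade_lie(1)] sup[OF grade_lie(2)] sup[OF grade_lie(3)] by (simp_all add: subset_antisym)
  then show ?thesis using f by (simp add: H_grp_def)
qed

section \<open>Factorisation of exp(-x) exp(y) for bijective B(x,y)\<close>

text \<open>
  On \<open>N = {n | T(V\<^sup>+,n,V\<^sup>+) = 0}\<close> the operators \<open>T(y,x)\<close> multiply like products \<open>yx\<close> in an associative
  algebra: \<open>T(y,u)T(y,x) = T(Q(y)u,x)\<close> and \<open>T(y,x)T(v,x) = T(y,Q(x)v)\<close>, whence
  \<open>T(y,B(x,y)u) = (1 - T(y,x)) T(y,u) (1 - T(y,x))\<close>.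
\<close>

lemma singular_fixed_zero:
  assumes N: "\<And>u v. Tp J u n v = 0" and fix_n: "Tm J y x n = n" and surj: "surj (Bergman J x y)"
  shows "n = 0"
proof -
  have r1: "Tm J (Qm J v u) s n = Tm J v u (Tm J v s n)" for v u s
  proof (rule two_cancel(2))
    have "Tm J n s (Tm J v u v) = Tm J (Tm J n s v) u v + Tm J v u (Tm J n s v)"
      using Tm_jordan[of n s v u v] by (simp add: N Tlin)
    also have "Tm J n s (Tm J v u v) = Tm J (Qm J v u) s n + Tm J (Qm J v u) s n"
      by (simp only: Q_double(2)[symmetric] Tlin Tm_sym[of n])
    finally show "Tm J (Qm J v u) s n + Tm J (Qm J v u) s n = Tm J v u (Tm J v s n) + Tm J v u (Tm J v s n)"
      by (simp only: Tm_sym[of n s v] Tm_sym[of "Tm J v s n" u v])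
  qed
  have r2: "Tm J v (Qp J s u) n = Tm J v s (Tm J u s n)" for v u s
  proof (rule two_cancel(2))
    have 1: "Tm J n s (Tm J u s v) = Tm J (Tm J n s u) s v + Tm J u s (Tm J n s v)"
      using Tm_jordan[of n s u s v] by (simp add: N Tlin)
    have 2: "Tm J u s (Tm J v s n) = Tm J (Tm J u s v) s n - Tm J v (Tp J s u s) n + Tm J v s (Tm J u s n)"
      by (rule Tm_jordan)
    show "Tm J v (Qp J s u) n + Tm J v (Qp J s u) n = Tm J v s (Tm J u s n) + Tm J v s (Tm J u s n)"
      using 1 2 unfolding Q_double(1)[symmetric] Tlin Tm_sym[of n s] Tm_sym[of "Tm J u s n" s v]
      by (simp add: algebra_simps)
  qed
  \<comment> \<open>In the last identity above, the rightmost factor 1 - T(y,x) kills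
    \<open>n\<close>.\<close>
  have "Tm J y (Bergman J x y u) n = 0" for u
  proof -
    have "Tm J y x (Tm J y u n) = Tm J (Tm J y x y) u n - Tm J y (Tp J x y u) n + Tm J y u (Tm J y x n)"
      by (rule Tm_jordan)
    then have 1: "Tm J y (Tp J x y u) n = Tm J y x (Tm J y u n) + Tm J y u n"
      unfolding Q_double(2)[symmetric] by (simp add: Tlin r1 fix_n algebra_simps)
    have 2: "Tm J y (Qp J x (Qm J y u)) n = Tm J y x (Tm J y u n)" by (simp add: r2 r1 fix_n)
    show ?thesis by (simp add: Bergman_def Tlin 1 2)
  qed
  then have "Tm J y v n = 0" for v using surj by (metis surjD)
  then show ?thesis using fix_n by metis
qed


text \<open>Write k = f exp(z) and k E = (0, (P, M), w). The point is that P = id and M = -id, so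
  that k E = exp(w) E; then exp(-w) k fixes E and lies in H.\<close>

lemma Bergman_bij_decomposition:
  assumes bij: "bij (Bergman J x y)"
  defines "z \<equiv> quasi_inverse J y x"
  defines "w \<equiv> y + Qm J y z"
  shows "\<exists>h\<in>H_grp J. hp h = Bergman J x y \<and>
    exp_p J (- x) \<otimes>\<^bsub>B\<^esub> exp_m J y \<otimes>\<^bsub>B\<^esub> exp_p J z = exp_m J w \<otimes>\<^bsub>B\<^esub> h"
proof -
  define f where "f = exp_p J (- x) \<otimes>\<^bsub>B\<^esub> exp_m J y"
  define k where "k = f \<otimes>\<^bsub>B\<^esub> exp_p J z"
  have f: "f \<in> carrier G" unfolding f_def by (intro Gm exp_car)
  have k: "k \<in> carrier G" unfolding k_def by (intro Gm f exp_car)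
  note kB = G_sub[OF k]
  note fl = G_lieaut[OF f, unfolded lieaut_def]
  note kl = G_lieaut[OF k, unfolded lieaut_def]
  have L: "(u,0,0) \<in> lie J" "(0,0,v) \<in> lie J" for u v by (auto simp: lie_iff)
  have f_app: "f X = exp_p J (- x) (exp_m J y X)" if "X \<in> lie J" for X
    unfolding f_def using that by (simp add: B_app exp_car[THEN G_sub])
  have k_app: "k X = f (exp_p J z X)" if "X \<in> lie J" for X
    unfolding k_def using that by (simp add: B_app exp_car[THEN G_sub] G_sub[OF f])
  have fu: "f (u,0,0) = (Bergman J x y u, inner_der J x (Qm J y u) - inner_der J u y, - Qm J y u)" for u
    by (simp add: f_app L exp_p_exp_m_val)
  have zu: "exp_p J z (u,0,0) = (u,0,0)" for u
    by (simp add: exp_val_grade_pm Qp_def inner_der_def Tlin prod_eq_iff fun_eq_iff)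
  have ku: "k (u,0,0) = (Bergman J x y u, inner_der J x (Qm J y u) - inner_der J u y, - Qm J y u)" for u
    by (simp add: k_app L zu fu)
  have Bz: "Bergman J x y z = x - Qp J x y"
    unfolding z_def quasi_inverse_def using bij by (simp add: bij_is_surj surj_f_inv_f)
  \<comment> \<open>The V^+ component of k E is -B(x,y)z + x - Q(x)y, which vanishes by the choice
    of z.\<close>
  have "exp_p J z Eu = (- z,0,0) + Eu" by (simp add: exp_Eu)
  then have "k Eu = f (- z,0,0) + f Eu" using fl L(1)[of "- z"] Eu(1) by (simp only: k_app)
  moreover have "Qm J y (- z) = - Qm J y z" by (simp add: Qm_def Tlin)
  ultimately have kE1: "fst (k Eu) = 0" "snd (snd (k Eu)) = w"
    unfolding fu f_app[OF Eu(1)] exp_p_exp_m_Eu by (simp_all add: Bergman_lin Bz w_def)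
  obtain P M where PM: "fst (snd (k Eu)) = (P, M)" by fastforce
  have kE: "k Eu = (0, (P, M), w)" using kE1 PM by (simp add: prod_eq_iff)
  have PM0: "(P, M) \<in> lie0 J" using B_in[OF kB Eu(1)] kE by (simp add: lie_iff)
  note d = der_derI[OF lie0_der[OF PM0]]
  have kb: "k (lie_bracket J Eu X) = lie_bracket J (0, (P, M), w) (k X)" if "X \<in> lie J" for X
    using kl that Eu(1) kE by simp
  \<comment> \<open>Compare V^+ components in [k E, k u] = k u for u in V^+. Surjectivity of B(x,y)
    then gives P = id.\<close>
  have "P (Bergman J x y u) = Bergman J x y u" for u
  proof -
    have "lie_bracket J (0, (P, M), w) (k (u,0,0)) = k (u,0,0)"
      using kb[OF L(1)] Eu_bracket[OF L(1)] by simp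
    then have "fst (lie_bracket J (0, (P, M), w) (k (u,0,0))) = Bergman J x y u" by (simp add: ku)
    then show ?thesis by (simp add: ku inner_der_def Tlin)
  qed
  then have P: "P u = u" for u using bij by (metis bij_is_surj surjD)
  \<comment> \<open>(P, M) is a derivation of the Jordan pair. With P = id the derivation rule
    leaves exactly this, so \<open>M v + v\<close> lies in the set N of
    \<open>singular_fixed_zero\<close>.\<close>
  have N: "Tp J u (M v + v) u' = 0" for u v u'
    using d(11)[of u v u'] by (simp add: P Tlin add.commute)
  have bM: "lie_bracket J (0, (P, M), w) (0,0,v) = (0,0,M v)" for v
    by (simp add: d inner_der_def Tlin prod_eq_iff fun_eq_iff zero_prod_def)
  have pull: "\<exists>X\<in>lie J. k X = (0,0,v)" for v
    using B_inv_app(1)[OF kB L(2)] B_in[OF BG.inv_closed[OF kB] L(2)] by blast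
  have inj: "X = Y" if "k X = k Y" "X \<in> lie J" "Y \<in> lie J" for X Y
    using that B_inv_app(2)[OF kB] by metis
  txt \<open>\<open>ad (k E)\<close> has the eigenvalues \<open>1, 0, -1\<close>; it remains to exclude \<open>1\<close> and \<open>0\<close> on \<open>V\<^sup>-\<close>.\<close>
  have M3: "M (M (M v)) = M v" for v
  proof -
    obtain X where X: "X \<in> lie J" "k X = (0,0,v)" using pull by blast
    have c: "lie_bracket J Eu Y \<in> lie J" if "Y \<in> lie J" for Y using that Eu(1) by (rule lie_bracket_closed[rotated])
    obtain a A b where Xe: "X = (a, A, b)" by (cases X) auto
    have "lie_bracket J Eu (lie_bracket J Eu (lie_bracket J Eu X)) = lie_bracket J Eu X"
      using X(1) unfolding Xe by (simp add: Eu_bracket lie_iff)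
    then have "k (lie_bracket J Eu (lie_bracket J Eu (lie_bracket J Eu X))) = k (lie_bracket J Eu X)" by simp
    then show ?thesis using X c by (simp add: kb bM)
  qed
  \<comment> \<open>Such a v is k u with u in V^+. Its V^+ component B(x,y)u is zero, so u = 0 by
    injectivity.\<close>
  have eig1: "v = 0" if v: "M v = v" for v
  proof -
    obtain X where X: "X \<in> lie J" "k X = (0,0,v)" using pull by blast
    have "k (lie_bracket J Eu X) = k X" using X v by (simp add: kb bM)
    then have "X \<in> grade_p" using inj X(1) Eu(1) by (simp add: grade_eigenspace lie_bracket_closed)
    then obtain u where u: "X = (u,0,0)" by (auto simp: grade_p_def)
    have "Bergman J x y u = Bergman J x y 0" using X(2) by (simp add: u ku Bergman_lin)
    then have "u = 0" using bij by (metis bij_is_inj injD)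
    then show ?thesis using X(2) by (simp add: u ku Qm_def Tlin)
  qed
  have M: "M v = - v" for v
  proof -
    \<comment> \<open>By \<open>M3\<close> the left-hand side is fixed by \<open>M\<close>. Hence
      \<open>M\<close> kills \<open>M v + v\<close>, whose preimage X under k therefore has grade
      0.\<close>
    have "M (M v) + M v = 0" by (rule eig1) (simp add: d M3 add.commute)
    then have n0: "M (M v + v) = 0" by (simp add: d)
    obtain X where X: "X \<in> lie J" "k X = (0,0,M v + v)" using pull by blast
    have "k (lie_bracket J Eu X) = (0,0,0)" unfolding kb[OF X(1)] X(2) bM n0 ..
    then have "k (lie_bracket J Eu X) = k 0"
      using lieaut_zero_neg(1)[OF G_lieaut[OF k]] by (simp add: zero_prod_def)
    then have "lie_bracket J Eu X = 0" 
      by (rule inj[OF _ lie_bracket_closed[OF Eu(1) X(1)]]) (simp add: lie_iff)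
    then have "X \<in> grade_0 J" using X(1) by (simp add: grade_eigenspace)
    then obtain A A' where A: "X = (0, (A, A'), 0)" "(A, A') \<in> lie0 J" by (auto simp: grade_0_def)
    have zX: "exp_p J z X \<in> lie J" by (rule B_in[OF G_sub[OF exp_car(1)] X(1)])
    \<comment> \<open>Undoing f gives B(y,x)(M v + v) = 0, since exp(z) X has no V^- component. By
      \<open>N\<close> the quadratic term drops out, so \<open>M v + v\<close> is fixed by
      T(y,x).\<close>
    have "exp_p J z X = exp_m J (- y) (exp_p J x (0,0,M v + v))"
    proof -
      have "(0,0,M v + v) = exp_p J (- x) (exp_m J y (exp_p J z X))" using X zX k_app f_app by simp
      moreover have "exp_p J x (exp_p J (- x) Y) = Y" "exp_m J (- y) (exp_m J y Y) = Y" if "Y \<in> lie J" for Y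
        using that B_app[OF exp_car(1)[THEN G_sub] exp_car(1)[THEN G_sub] that, of x "- x"]
          B_app[OF exp_car(2)[THEN G_sub] exp_car(2)[THEN G_sub] that, of "- y" y]
        by (simp_all add: exp_cancel B_one)
      ultimately show ?thesis using zX B_in[OF G_sub[OF exp_car(2)] zX] by simp
    qed
    moreover have "snd (snd (exp_p J z X)) = 0" using A by (simp add: exp_val)
    ultimately have "(M v + v) - Tm J y x (M v + v) + Qm J y (Qp J x (M v + v)) = 0"
      using exp_m_exp_p_val by metis
    then have "Tm J y x (M v + v) = M v + v" by (simp add: Qp_def N Qm_def Tlin(15,16,17,18) del: Tlin(6))
    then have "M v + v = 0" using N bij by (intro singular_fixed_zero[of _ y x]) (auto simp: bij_is_surj)
    then show ?thesis by (simp add: eq_neg_iff_add_eq_0)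
  qed
  have kEw: "k Eu = exp_m J w Eu" unfolding kE exp_Eu using P M by (simp add: fun_eq_iff)
  define h where "h = exp_m J (- w) \<otimes>\<^bsub>B\<^esub> k"
  have h: "h \<in> carrier G" unfolding h_def by (intro Gm exp_car k)
  have "h Eu = (exp_m J (- w) \<otimes>\<^bsub>B\<^esub> exp_m J w) Eu"
    unfolding h_def using Eu(1) by (simp add: B_app exp_car[THEN G_sub] kB kEw)
  then have "h Eu = Eu" using Eu(1) by (simp add: exp_cancel B_one)
  then have hH: "h \<in> H_grp J" using h by (intro stabilizer_Eu_H)
  have khw: "k = exp_m J w \<otimes>\<^bsub>B\<^esub> h"
    unfolding h_def using kB by (simp add: Ga[OF exp_car(2) exp_car(2) k, symmetric] exp_cancel)
  have "hp h u = Bergman J x y u" for u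
  proof -
    obtain C C' where C: "inner_der J x (Qm J y u) - inner_der J u y = (C, C')" by fastforce
    have "(C, C') \<in> lie0 J" unfolding C[symmetric] by (simp add: lie0_ops inner_lie0)
    from exp_val(2)[OF this] show ?thesis
      unfolding hp_def h_def using L by (simp add: B_app exp_car[THEN G_sub] kB ku C)
  qed
  then have "hp h = Bergman J x y" by (rule ext)
  then show ?thesis using hH khw unfolding k_def f_def by blast
qed


section \<open>Action on points and transversality\<close>

lemma exp_cancel_left:
  assumes "k \<in> carrier G"
  shows "exp_p J u \<otimes>\<^bsub>B\<^esub> (exp_p J (- u) \<otimes>\<^bsub>B\<^esub> k) = k" "exp_p J (- u) \<otimes>\<^bsub>B\<^esub> (exp_p J u \<otimes>\<^bsub>B\<^esub> k) = k"
    "exp_m J v \<otimes>\<^bsub>B\<^esub> (exp_m J (- v) \<otimes>\<^bsub>B\<^esub> k) = k" "exp_m J (- v) \<otimes>\<^bsub>B\<^esub> (exp_m J v \<otimes>\<^bsub>B\<^esub> k) = k"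
  using G_sub[OF assms] by (simp_all add: exp_cancel Ga[OF exp_car(1) exp_car(1) assms, symmetric]
      Ga[OF exp_car(2) exp_car(2) assms, symmetric])

lemma exp_H_in_P: "exp_p J u \<in> P_p J" "exp_m J v \<in> P_m J" "h \<in> H_grp J \<Longrightarrow> h \<in> P_p J" "h \<in> H_grp J \<Longrightarrow> h \<in> P_m J"
proof -
  have "\<one>\<^bsub>B\<^esub> \<in> H_grp J" using subgroup.one_closed[OF H_subgroup] by simp
  moreover have "exp_p J u = exp_p J u \<otimes>\<^bsub>B\<^esub> \<one>\<^bsub>B\<^esub>" "exp_m J v = exp_m J v \<otimes>\<^bsub>B\<^esub> \<one>\<^bsub>B\<^esub>"
    using exp_car[THEN G_sub] by simp_all
  ultimately show "exp_p J u \<in> P_p J" "exp_m J v \<in> P_m J" unfolding P_iff by blast+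
  show "h \<in> H_grp J \<Longrightarrow> h \<in> P_p J" "h \<in> H_grp J \<Longrightarrow> h \<in> P_m J" using P_Int by auto
qed

lemma act_absorb:
  assumes "k \<in> carrier G"
  shows "p \<in> P_p J \<Longrightarrow> act J (k \<otimes>\<^bsub>B\<^esub> p) (P_p J) = act J k (P_p J)"
    "p \<in> P_m J \<Longrightarrow> act J (k \<otimes>\<^bsub>B\<^esub> p) (P_m J) = act J k (P_m J)"
  using assms P_sub act_act[of k p "P_p J"] act_act[of k p "P_m J"]
    act_P[OF P_subgroup(1), of p] act_P[OF P_subgroup(2), of p] by auto

text \<open>The factor exp(w) h in the decomposition lies in P^- and so disappears in the
  coset.\<close>

lemma quasi_inverse_act:
  assumes "bij (Bergman J x y)"
  shows "act J (exp_m J (- y) \<otimes>\<^bsub>B\<^esub> exp_p J x) (P_m J) = act J (exp_p J (quasi_inverse J y x)) (P_m J)"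
proof -
  let ?z = "quasi_inverse J y x"
  obtain h where h: "h \<in> H_grp J"
    and e: "exp_p J (- x) \<otimes>\<^bsub>B\<^esub> exp_m J y \<otimes>\<^bsub>B\<^esub> exp_p J ?z = exp_m J (y + Qm J y ?z) \<otimes>\<^bsub>B\<^esub> h"
    using Bergman_bij_decomposition[OF assms] by blast
  note c = exp_car Gm H_sub[OF h]
  have "exp_m J (- y) \<otimes>\<^bsub>B\<^esub> exp_p J x \<otimes>\<^bsub>B\<^esub> (exp_m J (y + Qm J y ?z) \<otimes>\<^bsub>B\<^esub> h) = exp_p J ?z"
    unfolding e[symmetric] by (simp add: c Ga exp_cancel_left)
  moreover have "act J (exp_m J (- y) \<otimes>\<^bsub>B\<^esub> exp_p J x \<otimes>\<^bsub>B\<^esub> (exp_m J (y + Qm J y ?z) \<otimes>\<^bsub>B\<^esub> h)) (P_m J)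
      = act J (exp_m J (- y) \<otimes>\<^bsub>B\<^esub> exp_p J x) (P_m J)"
    using h by (intro act_absorb(2) Gm exp_car) (auto simp: P_iff)
  ultimately show ?thesis by simp
qed

lemma hp_bij: assumes h: "h \<in> H_grp J" shows "bij (hp h)"
proof (rule bijI)
  have L: "(u,0,0) \<in> lie J" for u by (simp add: lie_iff)
  show "inj (hp h)"
  proof (rule injI)
    fix u v assume "hp h u = hp h v"
    then have "h (u,0,0) = h (v,0,0)" by (simp add: H_val[OF h])
    then have "(u,0::('p \<Rightarrow> 'p) \<times> ('m \<Rightarrow> 'm),0::'m) = (v,0,0)" using B_inv_app(2)[OF G_sub[OF H_sub[OF h]] L] by metis
    then show "u = v" by simp
  qed
  have "\<exists>v. u = hp h v" for u
  proof -
    have "(u,0,0) \<in> h ` grade_p" using h by (simp add: H_grp_def grade_p_def)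
    then show ?thesis by (auto simp: grade_p_def H_val[OF h])
  qed
  then show "surj (hp h)" by (auto simp: surj_def)
qed

lemma transversal_exp_iff:
  "transversal J (act J (exp_p J x) (o_p J)) (act J (exp_m J y) (o_m J)) \<longleftrightarrow> bij (Bergman J x y)"
proof
  assume "bij (Bergman J x y)"
  let ?z = "quasi_inverse J y x"
  let ?w = "y + Qm J y ?z"
  obtain h where h: "h \<in> H_grp J"
    and e: "exp_p J (- x) \<otimes>\<^bsub>B\<^esub> exp_m J y \<otimes>\<^bsub>B\<^esub> exp_p J ?z = exp_m J ?w \<otimes>\<^bsub>B\<^esub> h"
    using Bergman_bij_decomposition[OF \<open>bij (Bergman J x y)\<close>] by blast
  note c = exp_car Gm H_sub[OF h]
  have e': "exp_p J x \<otimes>\<^bsub>B\<^esub> exp_m J ?w \<otimes>\<^bsub>B\<^esub> h = exp_m J y \<otimes>\<^bsub>B\<^esub> exp_p J ?z"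
    using e[symmetric] by (simp add: c Ga exp_cancel_left)
  \<comment> \<open>exp(x) exp(w) represents both points: exp(w) lies in P^-, and by
    \<open>e'\<close> it differs from exp(y) only by h and exp(z), which lie in P^+.\<close>
  have "act J (exp_p J x \<otimes>\<^bsub>B\<^esub> exp_m J ?w) (P_m J) = act J (exp_p J x) (P_m J)"
    by (rule act_absorb(2)[OF exp_car(1) exp_H_in_P(2)])
  moreover have "act J (exp_p J x \<otimes>\<^bsub>B\<^esub> exp_m J ?w) (P_p J) = act J (exp_m J y) (P_p J)"
    using act_absorb(1)[OF Gm[OF exp_car(1) exp_car(2)] exp_H_in_P(3)[OF h], of x ?w]
      act_absorb(1)[OF exp_car(2) exp_H_in_P(1), of y ?z] e' by simp
  ultimately show "transversal J (act J (exp_p J x) (o_p J)) (act J (exp_m J y) (o_m J))"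
    unfolding transversal_def o_eq using Gm[OF exp_car(1) exp_car(2)] by metis
next
  assume "transversal J (act J (exp_p J x) (o_p J)) (act J (exp_m J y) (o_m J))"
  then obtain k where k: "k \<in> carrier G" "act J (exp_p J x) (P_m J) = act J k (P_m J)"
      "act J (exp_m J y) (P_p J) = act J k (P_p J)"
    unfolding transversal_def o_eq by blast
  have "exp_p J (- x) \<otimes>\<^bsub>B\<^esub> k \<in> P_m J" "exp_m J (- y) \<otimes>\<^bsub>B\<^esub> k \<in> P_p J"
    using act_eq[OF P_subgroup(2) exp_car(1) k(1,2)] act_eq[OF P_subgroup(1) exp_car(2) k(1,3)] by (simp_all add: exp_invG)
  then obtain w h1 v h2 where h: "h1 \<in> H_grp J" "h2 \<in> H_grp J"
    and e1: "exp_p J (- x) \<otimes>\<^bsub>B\<^esub> k = exp_m J w \<otimes>\<^bsub>B\<^esub> h1"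
    and e2: "exp_m J (- y) \<otimes>\<^bsub>B\<^esub> k = exp_p J v \<otimes>\<^bsub>B\<^esub> h2" unfolding P_iff by blast
  note c = exp_car Gm H_sub[OF h(1)] H_sub[OF h(2)]
  have "k = exp_m J y \<otimes>\<^bsub>B\<^esub> (exp_p J v \<otimes>\<^bsub>B\<^esub> h2)" unfolding e2[symmetric] by (simp add: exp_cancel_left k)
  then have e: "exp_p J (- x) \<otimes>\<^bsub>B\<^esub> (exp_m J y \<otimes>\<^bsub>B\<^esub> (exp_p J v \<otimes>\<^bsub>B\<^esub> h2)) = exp_m J w \<otimes>\<^bsub>B\<^esub> h1" using e1 by simp
  \<comment> \<open>Apply both sides of \<open>e\<close> to u in V^+ and compare V^+ components:
    exp(v) fixes V^+ pointwise, and exp(w) does not change V^+ components.\<close>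
  have "Bergman J x y (hp h2 u) = hp h1 u" for u
  proof -
    have L: "(a,0,0) \<in> lie J" for a by (simp add: lie_iff)
    have "exp_p J v (hp h2 u,0,0) = (hp h2 u,0,0)"
      by (simp add: exp_val_grade_pm Qp_def inner_der_def Tlin prod_eq_iff fun_eq_iff)
    then have "fst ((exp_p J (- x) \<otimes>\<^bsub>B\<^esub> (exp_m J y \<otimes>\<^bsub>B\<^esub> (exp_p J v \<otimes>\<^bsub>B\<^esub> h2))) (u,0,0)) = Bergman J x y (hp h2 u)"
      by (simp add: B_app c[THEN G_sub] L H_val[OF h(2)] exp_p_exp_m_val)
    moreover have "fst ((exp_m J w \<otimes>\<^bsub>B\<^esub> h1) (u,0,0)) = hp h1 u"
      by (simp add: B_app c[THEN G_sub] L H_val[OF h(1)] exp_val_grade_pm)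
    ultimately show ?thesis using e by simp
  qed
  then have "Bergman J x y \<circ> hp h2 = hp h1" by auto
  then have "Bergman J x y = hp h1 \<circ> inv_into UNIV (hp h2)"
    using hp_bij[OF h(2)] by (metis bij_is_surj comp_assoc comp_id surj_iff)
  then show "bij (Bergman J x y)" using hp_bij[OF h(1)] hp_bij[OF h(2)] by (simp add: bij_comp bij_imp_bij_inv)
qed

lemma transversal_act_iff:
  assumes g: "g \<in> carrier G" and S: "X \<subseteq> carrier G" "A \<subseteq> carrier G"
  shows "transversal J (act J g X) (act J g A) \<longleftrightarrow> transversal J X A"
proof -
  have t: "transversal J (act J k X) (act J k A)" if "transversal J X A" "k \<in> carrier G" for k X A
  proof -
    obtain l where "l \<in> carrier G" "X = act J l (o_p J)" "A = act J l (o_m J)" using \<open>transversal J X A\<close> unfolding transversal_def by blast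
    then show ?thesis unfolding transversal_def using \<open>k \<in> carrier G\<close> by (intro bexI[of _ "k \<otimes>\<^bsub>B\<^esub> l"]) (auto simp: act_act o_eq P_sub Gm)
  qed
  show ?thesis using t[of X A g] t[of "act J g X" "act J g A" "inv\<^bsub>G\<^esub> g"] g act_inv(1)[OF g] S by auto
qed

lemma transversal_chart_iff:
  assumes "g \<in> carrier G"
  shows "transversal J (chart_p J g x) (chart_m J g a) \<longleftrightarrow> bij (Bergman J x (- a))"
  unfolding chart_p_def chart_m_def using assms
  by (simp add: transversal_act_iff act_sub exp_car o_eq P_sub transversal_exp_iff[unfolded o_eq])

section \<open>Charts of the dual space and midpoints\<close>

lemma chart_m_eq: "g \<in> carrier G \<Longrightarrow> chart_m J g w = act J (g \<otimes>\<^bsub>B\<^esub> exp_m J (- w)) (P_p J)"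
  unfolding chart_m_def o_eq by (rule act_act) (simp_all add: exp_car P_sub)

lemma chart_m_inj: assumes g: "g \<in> carrier G" and e: "chart_m J g u = chart_m J g v" shows "u = v"
proof -
  have "act J (exp_m J (- u)) (P_p J) = act J (exp_m J (- v)) (P_p J)"
    using e act_inv(1)[OF g act_sub[OF exp_car(2) P_sub(1)]] unfolding chart_m_def o_eq by metis
  from act_eq[OF P_subgroup(1) exp_car(2) exp_car(2) this]
  have "exp_m J (u + - v) \<in> P_p J" unfolding exp_add by (simp add: exp_invG)
  then show ?thesis using exp_in_P(2) by fastforce
qed

text \<open>The translation part is -w, not w, because of the sign in
  \<open>chart_m\<close>.\<close>

lemma chart_m_change:
  assumes g: "g \<in> carrier G" and h: "h \<in> H_grp J"
  shows "chart_m J (g \<otimes>\<^bsub>B\<^esub> (exp_m J w \<otimes>\<^bsub>B\<^esub> h)) u = chart_m J g (hm h u - w)"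
proof -
  note c = g H_sub[OF h] exp_car Gm
  have n: "w + hm h (- u) = - (hm h u - w)" using hp_lin(4)[OF h, of "-1" u] by simp
  have "chart_m J (g \<otimes>\<^bsub>B\<^esub> (exp_m J w \<otimes>\<^bsub>B\<^esub> h)) u
      = act J (g \<otimes>\<^bsub>B\<^esub> (exp_m J w \<otimes>\<^bsub>B\<^esub> (h \<otimes>\<^bsub>B\<^esub> exp_m J (- u)))) (P_p J)"
    using c by (simp add: chart_m_eq Ga)
  also have "\<dots> = act J ((g \<otimes>\<^bsub>B\<^esub> exp_m J (w + hm h (- u))) \<otimes>\<^bsub>B\<^esub> h) (P_p J)"
    unfolding H_exp[OF h] exp_add using c by (simp add: Ga)
  also have "\<dots> = chart_m J g (hm h u - w)"
    using c by (simp add: act_absorb(1) exp_H_in_P h chart_m_eq n)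
  finally show ?thesis .
qed

lemma P_m_change:
  assumes g: "g \<in> carrier G" "g' \<in> carrier G" and e: "act J g (o_p J) = act J g' (o_p J)"
  obtains w h where "h \<in> H_grp J" "g' = g \<otimes>\<^bsub>B\<^esub> (exp_m J w \<otimes>\<^bsub>B\<^esub> h)"
proof -
  have "inv\<^bsub>G\<^esub> g \<otimes>\<^bsub>G\<^esub> g' \<in> P_m J" using act_eq[OF P_subgroup(2) g] e o_eq by simp
  then obtain w h where h: "h \<in> H_grp J" "inv\<^bsub>G\<^esub> g \<otimes>\<^bsub>G\<^esub> g' = exp_m J w \<otimes>\<^bsub>G\<^esub> h" using P_iff by auto
  moreover have "g' = g \<otimes>\<^bsub>G\<^esub> (inv\<^bsub>G\<^esub> g \<otimes>\<^bsub>G\<^esub> g')" using g by (metis GG.inv_closed GG.m_assoc GG.r_inv GG.l_one)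
  ultimately show ?thesis using that by simp
qed

text \<open>Elements of G with the same image of o^+ differ by U^- H, so their charts differ by an
  affine map, and affine maps preserve combinations with coefficients 1 - r and r.\<close>

lemma Pi_m_chart:
  assumes g: "g \<in> carrier G"
  shows "Pi_m J r (chart_m J g u) (act J g (o_p J)) (chart_m J g v) = chart_m J g (scale_m J (1 - r) u + scale_m J r v)"
  unfolding Pi_m_def
proof (rule the_equality)
  show "\<exists>ga\<in>carrier G. \<exists>ua va. act J g (o_p J) = act J ga (o_p J) \<and> chart_m J g u = chart_m J ga ua \<and> chart_m J g v = chart_m J ga va \<and>
       chart_m J g (scale_m J (1 - r) u + scale_m J r v) = chart_m J ga (scale_m J (1 - r) ua + scale_m J r va)"
    using g by blast
next
  fix c assume "\<exists>ga\<in>carrier G. \<exists>ua va. act J g (o_p J) = act J ga (o_p J) \<and> chart_m J g u = chart_m J ga ua \<and> chart_m J g v = chart_m J ga va \<and>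
       c = chart_m J ga (scale_m J (1 - r) ua + scale_m J r va)"
  then obtain g' u' v' where g': "g' \<in> carrier G" "act J g (o_p J) = act J g' (o_p J)" "chart_m J g u = chart_m J g' u'"
     "chart_m J g v = chart_m J g' v'" and c: "c = chart_m J g' (scale_m J (1 - r) u' + scale_m J r v')" by blast
  obtain w h where h: "h \<in> H_grp J" "g' = g \<otimes>\<^bsub>B\<^esub> (exp_m J w \<otimes>\<^bsub>B\<^esub> h)" using P_m_change[OF g g'(1,2)] .
  note ch = chart_m_change[OF g h(1), of w, folded h(2)]
  have "u = hm h u' - w" "v = hm h v' - w" using g'(3,4) chart_m_inj[OF g] ch by simp_all
  then have "scale_m J (1 - r) u + scale_m J r v = hm h (scale_m J (1 - r) u' + scale_m J r v') - w"
    by (simp only: hp_lin[OF h(1)]) (simp add: m.scale_right_diff_distrib m.scale_left_diff_distrib)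
  then show "c = chart_m J g (scale_m J (1 - r) u + scale_m J r v)" using c ch by simp
qed

section \<open>The product mu in the chart\<close>

lemma Bergman_neg: "Bergman J (- x) y = Bergman J x (- y)"
  by (simp add: Bergman_def Qp_def Qm_def Tlin fun_eq_iff)

text \<open>Both sides solve the same linear equation, since B(-y,a) = B(y,-a) and the numerator
  changes sign.\<close>

lemma sigma_0_eq:
  assumes "bij (Bergman J y (- a))"
  shows "sigma_0 J a y = quasi_inverse J a (- y)"
proof -
  let ?B = "Bergman J y (- a)"
  have "?B (- inv_into UNIV ?B (y - Qp J y (- a))) = - y - Qp J (- y) a"
    using assms by (simp add: Bergman_lin bij_is_surj surj_f_inv_f Qp_def Tlin)
  then show ?thesis unfolding sigma_0_def quasi_inverse_def Bergman_neg
    using assms by (metis bij_is_inj inv_f_f)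
qed

lemma mu_chart:
  assumes g: "g \<in> carrier G" and bx: "bij (Bergman J x (- a))" and bv: "bij (Bergman J v (- a))"
  shows "mu J (chart_m J g a) (act J g (o_m J)) (chart_p J g x) (chart_p J g v)
    = chart_p J g (quad_map J a x (sigma_0 J a v))"
proof -
  define y where "y = - a"
  define z where "z = quasi_inverse J y x"
  define w where "w = y + Qm J y z"
  define q where "q = scale_m J half w"
  define s where "s = sigma_0 J a v"
  have B: "bij (Bergman J x y)" using bx by (simp add: y_def)
  obtain h where h: "h \<in> H_grp J" "hp h = Bergman J x y"
    and e: "exp_p J (- x) \<otimes>\<^bsub>B\<^esub> exp_m J y \<otimes>\<^bsub>B\<^esub> exp_p J z = exp_m J w \<otimes>\<^bsub>B\<^esub> h"
    using Bergman_bij_decomposition[OF B] unfolding w_def z_def by blast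
  have Bz: "Bergman J x y z = x - Qp J x y"
    unfolding z_def quasi_inverse_def using B by (simp add: bij_is_surj surj_f_inv_f)
  note c = g exp_car Gm H_sub[OF h(1)]
  \<comment> \<open>k moves o^+ to the point x; l still does so and also moves o^- to the midpoint
    of a and b seen from x.\<close>
  define k where "k = g \<otimes>\<^bsub>B\<^esub> exp_p J x"
  define l where "l = k \<otimes>\<^bsub>B\<^esub> exp_m J q"
  have kG: "k \<in> carrier G" and lG: "l \<in> carrier G" unfolding k_def l_def by (simp_all add: c)
  have xk: "chart_p J g x = act J k (o_p J)" by (simp add: chart_p_eq g k_def o_eq)
  have xl: "act J k (o_p J) = act J l (o_p J)"
    unfolding l_def o_eq by (simp add: act_absorb(2)[OF kG exp_H_in_P(2)])
  have bk: "act J g (o_m J) = chart_m J k 0"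
    unfolding chart_m_eq[OF kG] using act_absorb(1)[OF g exp_H_in_P(1), of x] G_sub[OF kG]
    by (simp add: exp_zero o_eq k_def)
  \<comment> \<open>By \<open>e\<close>, exp(x) exp(w) and exp(y) agree modulo P^+.\<close>
  have ak: "chart_m J g a = chart_m J k (- w)"
  proof -
    have "g \<otimes>\<^bsub>B\<^esub> exp_p J x \<otimes>\<^bsub>B\<^esub> exp_m J w \<otimes>\<^bsub>B\<^esub> h = g \<otimes>\<^bsub>B\<^esub> exp_m J y \<otimes>\<^bsub>B\<^esub> exp_p J z"
      using e[symmetric] by (simp add: c Ga exp_cancel_left)
    then have "act J (g \<otimes>\<^bsub>B\<^esub> exp_p J x \<otimes>\<^bsub>B\<^esub> exp_m J w) (P_p J) = act J (g \<otimes>\<^bsub>B\<^esub> exp_m J y) (P_p J)"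
      using act_absorb(1)[of "g \<otimes>\<^bsub>B\<^esub> exp_p J x \<otimes>\<^bsub>B\<^esub> exp_m J w" h]
        act_absorb(1)[of "g \<otimes>\<^bsub>B\<^esub> exp_m J y" "exp_p J z"] exp_H_in_P h(1) c by simp
    then show ?thesis by (simp add: chart_m_eq g kG k_def[symmetric] y_def)
  qed
  have hw: "scale_m J (1 - half) u = scale_m J half u" for u using half by (metis add_diff_cancel_right')
  have "Pi_m J half (chart_m J g a) (chart_p J g x) (act J g (o_m J)) = chart_m J k (- q)"
    unfolding xk ak bk Pi_m_chart[OF kG] by (simp add: hw q_def)
  also have "\<dots> = act J l (o_m J)" by (simp add: chart_m_eq[OF kG] l_def o_eq)
  finally have mid: "Pi_m J half (chart_m J g a) (chart_p J g x) (act J g (o_m J)) = act J l (o_m J)" .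
  have vX: "chart_p J g v \<in> X_p J" unfolding X_form chart_p_eq[OF g] by (rule bexI[of _ "g \<otimes>\<^bsub>B\<^esub> exp_p J v"]) (simp_all add: c)
  have r: "(-1::'k) dvd 1" by simp
  have r': "ring_inv (-1::'k) = -1" using ring_inv[OF r] by (metis minus_mult_minus mult_minus1 minus_minus)
  \<comment> \<open>m represents the point v as seen from l, that is, l m = g exp(v).\<close>
  define m where "m = exp_m J (- q) \<otimes>\<^bsub>B\<^esub> (exp_p J (- x) \<otimes>\<^bsub>B\<^esub> exp_p J v)"
  have mG: "m \<in> carrier G" unfolding m_def by (simp add: c)
  have lm: "l \<otimes>\<^bsub>B\<^esub> m = g \<otimes>\<^bsub>B\<^esub> exp_p J v" unfolding l_def k_def m_def by (simp add: c Ga exp_cancel_left)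
  have "act J l (act J m (P_m J)) = chart_p J g v" using lm act_act[OF lG mG P_sub(2)] by (simp add: chart_p_eq[OF g])
  then have lv: "act J (inv\<^bsub>G\<^esub> l) (chart_p J g v) = act J m (P_m J)"
    using act_inv(1)[OF lG act_sub[OF mG P_sub(2)]] by simp
  have cm: "cj (-1) m = exp_m J q \<otimes>\<^bsub>B\<^esub> (exp_p J x \<otimes>\<^bsub>B\<^esub> exp_p J (- v))"
    unfolding m_def using exp_car[THEN G_sub] by (simp add: cj_mult[OF r] cj_exp[OF r] r')
  have "mu J (chart_m J g a) (act J g (o_m J)) (chart_p J g x) (chart_p J g v)
      = act J l (coset_dil J (-1) (act J m (P_m J)))"
    unfolding mu_def mid unfolding xk xl Pi_p_ext_eq[OF r lG vX] lv ..
  also have "\<dots> = act J (l \<otimes>\<^bsub>B\<^esub> cj (-1) m) (P_m J)"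
    unfolding dil_act[OF r mG P_sub(2)] using cj_P[OF r] act_act[OF lG cj_G[OF r mG] P_sub(2)] by (simp add: coset_dil_cj)
  also have "l \<otimes>\<^bsub>B\<^esub> cj (-1) m
      = g \<otimes>\<^bsub>B\<^esub> exp_p J x \<otimes>\<^bsub>B\<^esub> exp_p J (x - Qp J x y) \<otimes>\<^bsub>B\<^esub> h \<otimes>\<^bsub>B\<^esub> (exp_m J y \<otimes>\<^bsub>B\<^esub> exp_p J (- v))"
  proof -
    have "cj (-1) (exp_p J (- x) \<otimes>\<^bsub>B\<^esub> exp_m J y \<otimes>\<^bsub>B\<^esub> exp_p J z) = cj (-1) (exp_m J w \<otimes>\<^bsub>B\<^esub> h)" using e by simp
    then have e2: "exp_m J (- w) \<otimes>\<^bsub>B\<^esub> h = exp_p J x \<otimes>\<^bsub>B\<^esub> (exp_m J (- y) \<otimes>\<^bsub>B\<^esub> exp_p J (- z))"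
      using c(2,3,5)[THEN G_sub] by (simp add: cj_mult[OF r] cj_exp[OF r] cj_H[OF r h(1)] r' c Ga)
    have "h = exp_m J w \<otimes>\<^bsub>B\<^esub> (exp_m J (- w) \<otimes>\<^bsub>B\<^esub> h)" by (simp add: exp_cancel_left c)
    then have "h \<otimes>\<^bsub>B\<^esub> exp_p J z \<otimes>\<^bsub>B\<^esub> exp_m J y
        = exp_m J w \<otimes>\<^bsub>B\<^esub> (exp_p J x \<otimes>\<^bsub>B\<^esub> (exp_m J (- y) \<otimes>\<^bsub>B\<^esub> exp_p J (- z))) \<otimes>\<^bsub>B\<^esub> exp_p J z \<otimes>\<^bsub>B\<^esub> exp_m J y"
      unfolding e2 by simp
    also have "\<dots> = exp_m J w \<otimes>\<^bsub>B\<^esub> exp_p J x"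
      using c(2,3)[THEN G_sub] by (simp add: c Ga exp_cancel_left exp_cancel)
    finally have e3: "exp_m J w \<otimes>\<^bsub>B\<^esub> exp_p J x = exp_p J (x - Qp J x y) \<otimes>\<^bsub>B\<^esub> h \<otimes>\<^bsub>B\<^esub> exp_m J y"
      unfolding H_exp[OF h(1)] h(2) Bz by simp
    \<comment> \<open>One factor exp(q) comes from l, the other from m after the dilation has
      reversed its sign. Together they restore exp(w).\<close>
    have qq: "exp_m J w = exp_m J q \<otimes>\<^bsub>B\<^esub> exp_m J q" by (simp flip: exp_add add: q_def half_m)
    have "l \<otimes>\<^bsub>B\<^esub> cj (-1) m = g \<otimes>\<^bsub>B\<^esub> exp_p J x \<otimes>\<^bsub>B\<^esub> (exp_m J w \<otimes>\<^bsub>B\<^esub> exp_p J x) \<otimes>\<^bsub>B\<^esub> exp_p J (- v)"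
      unfolding cm l_def k_def qq by (simp add: c Ga)
    then show ?thesis unfolding e3 by (simp add: c Ga)
  qed
  also have "act J \<dots> (P_m J)
      = act J (g \<otimes>\<^bsub>B\<^esub> exp_p J x \<otimes>\<^bsub>B\<^esub> exp_p J (x - Qp J x y) \<otimes>\<^bsub>B\<^esub> h) (act J (exp_m J y \<otimes>\<^bsub>B\<^esub> exp_p J (- v)) (P_m J))"
    by (rule act_act[symmetric]) (simp_all add: c P_sub)
  \<comment> \<open>Since y = -a, this point is the quasi-inverse of -v with respect to a, which is
    \<sigma>_0(v).\<close>
  also have "act J (exp_m J y \<otimes>\<^bsub>B\<^esub> exp_p J (- v)) (P_m J) = act J (exp_p J s) (P_m J)"
    using quasi_inverse_act[of "- v" a] bv unfolding s_def sigma_0_eq[OF bv] by (simp add: Bergman_neg y_def)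
  also have "act J (g \<otimes>\<^bsub>B\<^esub> exp_p J x \<otimes>\<^bsub>B\<^esub> exp_p J (x - Qp J x y) \<otimes>\<^bsub>B\<^esub> h) (act J (exp_p J s) (P_m J))
      = act J (g \<otimes>\<^bsub>B\<^esub> exp_p J x \<otimes>\<^bsub>B\<^esub> exp_p J (x - Qp J x y) \<otimes>\<^bsub>B\<^esub> (h \<otimes>\<^bsub>B\<^esub> exp_p J s)) (P_m J)"
    by (subst act_act) (simp_all add: c P_sub Ga)
  also have "\<dots> = act J (g \<otimes>\<^bsub>B\<^esub> exp_p J (x + (x - Qp J x y) + Bergman J x y s) \<otimes>\<^bsub>B\<^esub> h) (P_m J)"
    unfolding H_exp[OF h(1)] h(2) exp_add by (simp add: c Ga)
  also have "\<dots> = chart_p J g (x + (x - Qp J x y) + Bergman J x y s)"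
    by (simp add: act_absorb(2) exp_H_in_P h c chart_p_eq)
  also have "x + (x - Qp J x y) + Bergman J x y s = quad_map J a x s"
    using p.scale_left_distrib[of 1 1 x] by (simp add: quad_map_def translation_def y_def Qp_def Tlin add_ac)
  finally show ?thesis unfolding s_def .
qed

end

section \<open>Identification of U_{a,b} with U_a at an arbitrary base point\<close>

theorem theorem3p3:
  fixes J :: "('k::comm_ring_1, 'p::ab_group_add, 'm::ab_group_add) jordan_data"
    and a b p :: "('p, 'm) point"
    and g :: "('p, 'm) tkk \<Rightarrow> ('p, 'm) tkk"
  assumes "jordan_pair J"
    and "a \<in> X_m J" and "b \<in> X_m J"
    and "U_ab J a b \<noteq> {}"
    and "p \<in> U_ab J a b"
    and "g \<in> carrier (proj_group J)"
    and "p = act J g (o_p J)" and "b = act J g (o_m J)"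
  shows "(\<exists>!\<alpha>. chart_m J g \<alpha> = a) \<and>
    (\<forall>\<alpha>. chart_m J g \<alpha> = a \<longrightarrow>
       bij_betw (chart_p J g) (U_chart J \<alpha>) (U_ab J a b) \<and>
       (\<forall>x\<in>U_chart J \<alpha>. \<forall>y\<in>U_chart J \<alpha>.
          mu J a b (chart_p J g x) (chart_p J g y) = chart_p J g (quad_map J \<alpha> x (sigma_0 J \<alpha> y))) \<and>
       (\<forall>y\<in>U_chart J \<alpha>. sigma_0 J \<alpha> y = quasi_inverse J \<alpha> (- y)))"
proof -
  interpret jordan_pair J by fact
  note g = \<open>g \<in> carrier G\<close>
  have p0: "act J k (o_p J) = chart_p J k 0" if "k \<in> carrier G" for k
    using G_sub[OF that] by (simp add: chart_p_eq[OF that] exp_zero o_eq)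
  have m0: "act J k (o_m J) = chart_m J k 0" if "k \<in> carrier G" for k
    using G_sub[OF that] by (simp add: chart_m_eq[OF that] exp_zero o_eq)
  \<comment> \<open>Since p is transversal to a, some g' moves (o^+, o^-) to (p, a). It differs from
    g by an element of P^-, which puts a in the chart of g.\<close>
  obtain g' where g': "g' \<in> carrier G" "p = act J g' (o_p J)" "a = act J g' (o_m J)"
    using assms(5) by (auto simp: U_ab_def v_of_m_def transversal_def)
  obtain w h where "h \<in> H_grp J" "g' = g \<otimes>\<^bsub>B\<^esub> (exp_m J w \<otimes>\<^bsub>B\<^esub> h)"
    using P_m_change[OF g g'(1)] g'(2) assms(7) by metis
  then have "a = chart_m J g (hm h 0 - w)" using g'(3) m0[OF g'(1)] chart_m_change[OF g] by simp
  then have "\<exists>!\<alpha>. chart_m J g \<alpha> = a" using chart_m_inj[OF g] by metis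
  moreover have "bij_betw (chart_p J g) (U_chart J \<alpha>) (U_ab J a b)" if \<alpha>: "chart_m J g \<alpha> = a" for \<alpha>
    unfolding bij_betw_def
  proof
    show "inj_on (chart_p J g) (U_chart J \<alpha>)" using chart_p_inj[OF g] by (auto intro: inj_onI)
    have X: "chart_p J g x \<in> X_p J" for x
      unfolding X_form chart_p_eq[OF g] using Gm[OF g exp_car(1)] by blast
    \<comment> \<open>b is the origin of the dual chart, and B(x,0) = id.\<close>
    have tb: "transversal J (chart_p J g x) b" for x
      unfolding assms(8) m0[OF g] transversal_chart_iff[OF g]
      by (rule o_bij[of id]) (auto simp: fun_eq_iff Bergman_def Qm_def Qp_def Tlin)
    have ta: "transversal J (chart_p J g x) a \<longleftrightarrow> x \<in> U_chart J \<alpha>" for x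
      using transversal_chart_iff[OF g, of x \<alpha>] \<alpha> by (simp add: U_chart_iff)
    have "\<exists>x. q = chart_p J g x" if "q \<in> U_ab J a b" for q
    proof -
      have "transversal J q b" using that by (simp add: U_ab_def v_of_m_def)
      then obtain k where k: "k \<in> carrier G" "q = act J k (o_p J)" "b = act J k (o_m J)"
        unfolding transversal_def by blast
      obtain w h where "h \<in> H_grp J" "k = g \<otimes>\<^bsub>B\<^esub> (exp_p J w \<otimes>\<^bsub>B\<^esub> h)"
        using P_p_change[OF g k(1)] k(3) assms(8) by metis
      then have "q = chart_p J g (w + hp h 0)" using k(2) p0[OF k(1)] chart_p_change[OF g] by simp
      then show ?thesis ..
    qed
    moreover have "chart_p J g x \<in> U_ab J a b \<longleftrightarrow> x \<in> U_chart J \<alpha>" for x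
      by (simp add: U_ab_def v_of_m_def X ta tb)
    ultimately show "chart_p J g ` U_chart J \<alpha> = U_ab J a b" by auto
  qed
  moreover have "mu J a b (chart_p J g x) (chart_p J g y) = chart_p J g (quad_map J \<alpha> x (sigma_0 J \<alpha> y))"
    if "chart_m J g \<alpha> = a" "x \<in> U_chart J \<alpha>" "y \<in> U_chart J \<alpha>" for \<alpha> x y
    using mu_chart[OF g, of x \<alpha> y] that assms(8) by (simp add: U_chart_iff)
  ultimately show ?thesis using sigma_0_eq by (auto simp: U_chart_iff)
qed

end
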